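(* Let the ILRFPP model on $\mathbb{Z}^d$ satisfy the standing assumptions (with any $\alpha>0$). Then for every $x\in\mathbb{R}^d$ with $\|x\|_\infty\le1$ there is a constant $C=C(x)<\infty$ such that, with $T_n:=T(0,\lceil nx\rceil)$, $$\mathbb{P}\big(T_n>Cn\big)\xrightarrow[n\to\infty]{}0,$$ that is, $T_n=O_{\mathbb{P}}(n)$.
   Context: Model (inhomogeneous long-range first-passage percolation, ILRFPP). Fix an integer $d\ge1$ and $\alpha>0$; $\|\cdot\|$ is the $\ell_1$ norm on $\mathbb{Z}^d$. The vertex weights $(V_x)_{x\in\mathbb{Z}^d}$ are i.i.d. with the law of a random variable $V$; the edge noises $\omega_{xy}=\omega_{yx}\ge0$, one for every unordered pair $\{x,y\}$ of distinct vertices of $\mathbb{Z}^d$ (all pairs are edges), are i.i.d. with the law of $\omega$, and independent of the vertex weights. The passage time of an edge is $W_{xy}:=\|x-y\|^{\alpha}\,\omega_{xy}/(V_xV_y)$. A path is a finite sequence of distinct vertices; its passage time is the sum of $W$ over its consecutive edges. $T(x,y)$ is the infimum of the passage times over all finite self-avoiding paths from $x$ to $y$ (so $T(x,x)=0$). $\lceil nx\rceil$ is the coordinatewise ceiling. Standing assumptions: for fixed $\gamma,\theta,\zeta>0$, $\mathbb{P}(0<V<\infty)=1$ and $\lim_{x\to\infty}\log\mathbb{P}(V\ge x)/\log x=-\gamma$; $\lim_{x\downarrow0}\log\mathbb{P}(\omega\le x)/\log x=\theta$ and $\mathbb{E}\,\omega^{\zeta}<\infty$. *)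

theory Defs
  imports "HOL-Probability.Probability"
begin

definition l1_norm :: "int ^ 'd \<Rightarrow> int" where
  "l1_norm x = (\<Sum>i\<in>UNIV. \<bar>x $ i\<bar>)"

definition ceiling_vec :: "real ^ 'd \<Rightarrow> int ^ 'd" where
  "ceiling_vec x = (\<chi> i. \<lceil>x $ i\<rceil>)"

text \<open>An edge is an unordered pair, so noises indexed by edges are symmetric by
  construction.\<close>

definition edges :: "(int ^ 'd) set set" where
  "edges = {{x, y} | x y. x \<noteq> y}"

text \<open>Below, \<open>v\<close> and \<open>w\<close> are one realization of the vertex weights
  and of the edge noises.\<close>

definition edge_time ::
  "real \<Rightarrow> (int ^ 'd \<Rightarrow> real) \<Rightarrow> ((int ^ 'd) set \<Rightarrow> real) \<Rightarrow> int ^ 'd \<Rightarrow> int ^ 'd \<Rightarrow> real" where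
  "edge_time \<alpha> v w x y = real_of_int (l1_norm (x - y)) powr \<alpha> * w {x, y} / (v x * v y)"

definition path_time ::
  "real \<Rightarrow> (int ^ 'd \<Rightarrow> real) \<Rightarrow> ((int ^ 'd) set \<Rightarrow> real) \<Rightarrow> (int ^ 'd) list \<Rightarrow> real" where
  "path_time \<alpha> v w p = (\<Sum>i<length p - 1. edge_time \<alpha> v w (p ! i) (p ! Suc i))"

definition paths :: "int ^ 'd \<Rightarrow> int ^ 'd \<Rightarrow> (int ^ 'd) list set" where
  "paths x y = {p. p \<noteq> [] \<and> distinct p \<and> hd p = x \<and> last p = y}"

text \<open>The infimum is taken in the complete lattice \<^typ>\<open>ereal\<close>, which keeps it meaningful on
  the null event where some weight is not positive or some noise is negative.\<close>

definition passage_time ::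
  "real \<Rightarrow> (int ^ 'd \<Rightarrow> real) \<Rightarrow> ((int ^ 'd) set \<Rightarrow> real) \<Rightarrow> int ^ 'd \<Rightarrow> int ^ 'd \<Rightarrow> ereal" where
  "passage_time \<alpha> v w x y = (INF p \<in> paths x y. ereal (path_time \<alpha> v w p))"

text \<open>\<open>\<mu>\<^sub>V\<close> and \<open>\<mu>\<^sub>\<omega>\<close> are the laws of \<open>V\<close> and \<open>\<omega>\<close>. Independence is joint: all vertex
  weights and all edge noises form a single independent family, indexed by the disjoint sum of
  vertices and edges. The convention \<open>ln 0 = 0\<close> does no harm in the two tail assumptions: were
  a tail probability eventually zero, the limit would be \<open>0\<close>, contradicting
  \<open>\<gamma>, \<theta> > 0\<close>.\<close>

locale ilrfpp = prob_space M
  for M :: "'a measure" +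
  fixes V :: "int ^ 'd \<Rightarrow> 'a \<Rightarrow> real"
    and \<omega> :: "(int ^ 'd) set \<Rightarrow> 'a \<Rightarrow> real"
    and \<mu>\<^sub>V \<mu>\<^sub>\<omega> :: "real measure"
    and \<alpha> \<gamma> \<theta> \<zeta> :: real
  assumes alpha_pos: "\<alpha> > 0"
    and gamma_pos: "\<gamma> > 0"
    and theta_pos: "\<theta> > 0"
    and zeta_pos: "\<zeta> > 0"
    and indep: "indep_vars (\<lambda>_. borel) (case_sum V \<omega>) (UNIV <+> edges)"
    and law_V: "\<And>x. distr M borel (V x) = \<mu>\<^sub>V"
    and law_noise: "\<And>e. e \<in> edges \<Longrightarrow> distr M borel (\<omega> e) = \<mu>\<^sub>\<omega>"
    and V_pos: "AE v in \<mu>\<^sub>V. 0 < v"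
    and V_tail: "((\<lambda>t. ln (measure \<mu>\<^sub>V {t..}) / ln t) \<longlongrightarrow> - \<gamma>) at_top"
    and noise_nonneg: "AE w in \<mu>\<^sub>\<omega>. 0 \<le> w"
    and noise_tail: "((\<lambda>t. ln (measure \<mu>\<^sub>\<omega> {..t}) / ln t) \<longlongrightarrow> \<theta>) (at_right 0)"
    and noise_moment: "integrable \<mu>\<^sub>\<omega> (\<lambda>w. w powr \<zeta>)"

end

theory Submission
  imports Defs "HOL-Real_Asymp.Real_Asymp"
begin

text \<open>
  Bounding \<open>T\<^sub>n\<close> by a nearest-neighbour path fails: a weight may be close to \<open>0\<close> with a probability
  that decays as slowly as one likes, and a noise may have only a small moment, so a single edge
  can have infinite mean passage time. Long edges repair both defects, already in one dimension.

  Only the vertices \<open>u 0, u 1, u 2, \<dots>\<close> on the rounded ray from \<open>0\<close> through \<open>\<lceil>n x\<rceil>\<close> are used. The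
  ray is injective and the distance from \<open>u a\<close> to \<open>u b\<close> is at most the dimension times \<open>\<bar>a - b\<bar>\<close>,
  so that the problem becomes one about independent weights on positions and independent noises on
  pairs of positions.

  The positions are cut into blocks of \<open>k + 1\<close>, and a block is good if all its weights are at least
  \<open>\<delta>\<close>, where \<open>\<delta> > 0\<close> is such that this has some probability \<open>q > 0\<close>. The path visits good blocks
  only. The runs of bad blocks that it leaps over have geometric tails, so every power of their
  length has finite moments, whatever \<open>\<alpha>\<close> is. To hop from the first position of a good block, its
  hub, to the next good hub, the path may stop at any of the \<open>k\<close> other positions of the block. The
  cheapest of these \<open>k\<close> detours costs at most their geometric mean (\<open>cheap_detour\<close>), and the second
  moment of that involves only moments of order \<open>2 / k \<le> \<zeta>\<close> of single noises.

  A fixed constant \<open>C\<close> needs a law of large numbers and not only a bound on the mean. If leaps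
  are truncated at \<open>R\<close> blocks, the hop cost at block \<open>i\<close> depends on the quality of the next \<open>R\<close> blocks
  and on noises of pairs whose smaller position lies in block \<open>i\<close>; hence hop costs at distance \<open>R\<close> or more
  are independent (\<open>hop_cost_indep\<close>), and Chebyshev's inequality bounds the sum of \<open>m\<close> of them by
  a multiple of \<open>m\<close> up to probability of order \<open>R / m\<close> (\<open>local_dependence_deviation\<close>). With \<open>R\<close> of
  order \<open>(ln n)\<^sup>2\<close>, with high probability no leap of more than \<open>R\<close> blocks is needed, and the two edges
  that join the end points to the chain of hubs cost \<open>o(n)\<close>.
\<close>

section \<open>The ray and cheap detours\<close>

text \<open>With \<open>N\<close> the largest absolute coordinate of \<open>z\<close>, this is the rounded straight line from \<open>0\<close>
  through \<open>z\<close>, reached at time \<open>N\<close>. It is continued beyond \<open>z\<close>, so that every natural number is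
  a position and no boundary has to be treated in the one-dimensional model.\<close>

definition ray :: "int ^ 'd \<Rightarrow> nat \<Rightarrow> nat \<Rightarrow> int ^ 'd" where
  "ray z N i = (\<chi> c. (int i * z $ c) div int N)"

lemma ray_0 [simp]: "ray z N 0 = 0"
  by (simp add: ray_def vec_eq_iff)

lemma ray_end: "N > 0 \<Longrightarrow> ray z N N = z"
  by (simp add: ray_def vec_eq_iff)

text \<open>The extremal coordinate moves by exactly one unit per step.\<close>

lemma inj_ray:
  assumes "N > 0" "\<bar>z $ c\<bar> = int N"
  shows "inj (ray z N)"
proof (rule injI)
  fix i j assume "ray z N i = ray z N j"
  then have eq: "(int i * z $ c) div int N = (int j * z $ c) div int N"
    by (simp add: ray_def vec_eq_iff)
  from assms(2) consider "z $ c = int N" | "z $ c = - int N" by linarith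
  then show "i = j"
    using eq assms(1) by cases (simp_all flip: mult_minus_left)
qed

text \<open>Each coordinate is the floor of a linear function whose slope is at most \<open>1\<close> in absolute value.\<close>

lemma l1_norm_ray_diff:
  fixes z :: "int ^ 'd"
  assumes "N > 0" "\<And>c. \<bar>z $ c\<bar> \<le> int N" "a \<le> b"
  shows "l1_norm (ray z N a - ray z N b) \<le> int (CARD('d) * (b - a))"
proof -
  have "\<bar>(int a * z $ c) div int N - (int b * z $ c) div int N\<bar> \<le> int (b - a)" for c
  proof -
    define e where "e = int b - int a"
    have e: "e \<ge> 0" "int b = int a + e" using assms(3) by (auto simp: e_def)
    have z: "- int N \<le> z $ c" "z $ c \<le> int N" using assms(2)[of c] by linarith+
    have "e * z $ c \<le> e * int N" "- (e * int N) \<le> e * z $ c"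
      using mult_left_mono[OF z(2) e(1)] mult_left_mono[OF z(1) e(1)] by simp_all
    then have "int b * z $ c \<le> int a * z $ c + e * int N"
      "int a * z $ c + (- e) * int N \<le> int b * z $ c"
      by (simp_all add: e(2) algebra_simps)
    then have "(int b * z $ c) div int N \<le> (int a * z $ c + e * int N) div int N"
      "(int a * z $ c + (- e) * int N) div int N \<le> (int b * z $ c) div int N"
      using assms(1) by (auto intro: zdiv_mono1 simp del: div_mult_self1)
    then show ?thesis using assms(1,3) by (simp add: e_def)
  qed
  then have "l1_norm (ray z N a - ray z N b) \<le> (\<Sum>c\<in>(UNIV::'d set). int (b - a))"
    unfolding l1_norm_def ray_def by (intro sum_mono) simp
  then show ?thesis by simp
qed

text \<open>A moment of order \<open>p\<close> of \<open>boost k\<close> costs only a moment of order \<open>p / k\<close> of the noise. The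
  summand \<open>1\<close> makes products of boosts dominate sums of the underlying powers.\<close>

definition boost :: "nat \<Rightarrow> real \<Rightarrow> real" where
  "boost k w = 1 + w powr (1 / real k)"

lemma boost_ge_1: "1 \<le> boost k w"
  by (simp add: boost_def)

lemma borel_measurable_boost [measurable]: "boost k \<in> borel_measurable borel"
  unfolding boost_def[abs_def] by measurable

text \<open>The cheapest of \<open>k\<close> two-edge detours costs at most the geometric mean of all of them. Taking
  \<open>k\<close>-th roots before multiplying turns this into a product of single-noise factors, which has the
  integrability that no single noise needs to have.\<close>

lemma cheap_detour:
  fixes a b :: "nat \<Rightarrow> real"
  assumes k: "k \<ge> 1" and nonneg: "\<And>r. r \<in> {1..k} \<Longrightarrow> a r \<ge> 0 \<and> b r \<ge> 0"
  shows "\<exists>r\<in>{1..k}. a r + b r \<le> (\<Prod>r\<in>{1..k}. boost k (a r) * boost k (b r))"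
proof -
  define y where "y r = boost k (a r) * boost k (b r)" for r
  have y1: "y r \<ge> 1" for r
    using mult_mono[OF boost_ge_1 boost_ge_1, of k "a r" k "b r"] boost_ge_1[of k "a r"]
    by (simp add: y_def)
  obtain r where r: "r \<in> {1..k}" and min: "\<And>s. s \<in> {1..k} \<Longrightarrow> y r \<le> y s"
    using ex_min_if_finite[of "y ` {1..k}"] k
    by (auto simp: not_less)
  have pw: "(w powr (1 / real k)) ^ k = w" if "w \<ge> 0" for w :: real
    using that k by (cases "w = 0") (simp_all add: powr_power)
  have super: "p ^ k + t ^ k \<le> (p + t) ^ k" if "p \<ge> 0" "t \<ge> 0" for p t :: real
    using k
  proof (induction k rule: dec_induct)
    case (step n)
    have "p ^ Suc n + t ^ Suc n \<le> (p + t) * (p ^ n + t ^ n)"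
      using that by (simp add: algebra_simps)
    also have "\<dots> \<le> (p + t) * (p + t) ^ n"
      using that step by (intro mult_left_mono) auto
    finally show ?case by simp
  qed simp
  \<comment> \<open>By \<open>p ^ k + t ^ k \<le> (p + t) ^ k\<close>, applied to the \<open>k\<close>-th roots.\<close>
  have "a r + b r \<le> (a r powr (1 / real k) + b r powr (1 / real k)) ^ k"
    using super[of "a r powr (1 / real k)" "b r powr (1 / real k)"] pw nonneg[OF r] by simp
  also have "\<dots> \<le> y r ^ k"
    by (intro power_mono) (auto simp: y_def boost_def algebra_simps)
  also have "\<dots> = (\<Prod>s\<in>{1..k}. y r)" by simp
  also have "\<dots> \<le> (\<Prod>s\<in>{1..k}. y s)"
    using y1 min by (intro prod_mono) (meson order_trans zero_le_one)
  finally show ?thesis using r unfolding y_def by blast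
qed

text \<open>Block \<open>i\<close> consists of the \<open>k + 1\<close> positions \<open>hub k i, \<dots>, hub k i + k\<close>: its hub and \<open>k\<close>
  possible intermediate stops. Position \<open>0\<close>, the origin of the ray, lies in no block.\<close>

definition hub :: "nat \<Rightarrow> nat \<Rightarrow> nat" where
  "hub k i = i * (k + 1) + 1"

text \<open>A configuration \<open>y\<close> of the line model has an entry \<open>y (Inl i)\<close>, equal to \<open>1\<close> if block \<open>i\<close> is
  good and to \<open>0\<close> if it is bad, and an entry \<open>y (Inr (a, b))\<close>, the noise between the positions
  \<open>a < b\<close>.\<close>

definition detour_bound :: "nat \<Rightarrow> (nat + nat \<times> nat \<Rightarrow> real) \<Rightarrow> nat \<Rightarrow> nat \<Rightarrow> real" where
  "detour_bound k y i j = (\<Prod>r\<in>{1..k}.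
     boost k (y (Inr (hub k i, hub k i + r))) * boost k (y (Inr (hub k i + r, hub k j))))"

text \<open>This vanishes unless \<open>i + s\<close> is the first good block after \<open>i\<close>. It is a product of functions of
  single independent entries of \<open>y\<close>, so its moments factorize.\<close>

definition hop_term :: "nat \<Rightarrow> (nat + nat \<times> nat \<Rightarrow> real) \<Rightarrow> nat \<Rightarrow> nat \<Rightarrow> real" where
  "hop_term k y i s =
     (\<Prod>l\<in>{1..<s}. 1 - y (Inl (i + l))) * y (Inl (i + s)) * detour_bound k y i (i + s)"

text \<open>The truncation to leaps of at most \<open>R\<close> blocks makes the costs of distant blocks independent.\<close>

definition hop_cost :: "nat \<Rightarrow> real \<Rightarrow> nat \<Rightarrow> (nat + nat \<times> nat \<Rightarrow> real) \<Rightarrow> nat \<Rightarrow> real" where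
  "hop_cost k \<alpha> R y i = (\<Sum>s\<in>{1..R}. real s powr \<alpha> * hop_term k y i s)"

lemma hub_mono: "i < j \<Longrightarrow> hub k i + k < hub k j"
proof -
  assume "i < j"
  then have "Suc i * (k + 1) \<le> j * (k + 1)" by (intro mult_le_mono1) simp
  then show ?thesis by (simp add: hub_def)
qed

lemma detour_bound_ge_1: "1 \<le> detour_bound k y i j"
  unfolding detour_bound_def
  using mult_mono[OF boost_ge_1 boost_ge_1]
  by (intro prod_ge_1) (smt (verit, best) boost_ge_1 mult_le_cancel_right1)

lemma hop_term_nonneg:
  assumes "\<And>l. y (Inl l) \<in> {0, 1}"
  shows "0 \<le> hop_term k y i s"
  unfolding hop_term_def
proof (intro mult_nonneg_nonneg prod_nonneg)
  fix l
  show "0 \<le> 1 - y (Inl (i + l))" "0 \<le> y (Inl (i + s))"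
    using assms[of "i + l"] assms[of "i + s"] by auto
  show "0 \<le> detour_bound k y i (i + s)" using detour_bound_ge_1[of k y i "i + s"] by linarith
qed

lemma hop_cost_nonneg:
  assumes "\<And>l. y (Inl l) \<in> {0, 1}"
  shows "0 \<le> hop_cost k \<alpha> R y i"
  unfolding hop_cost_def
  by (intro sum_nonneg mult_nonneg_nonneg hop_term_nonneg[where y = y] assms) simp

lemma hop_cost_ge_next:
  assumes "\<And>l. y (Inl l) \<in> {0, 1}"
    and "s \<in> {1..R}" "y (Inl (i + s)) = 1" "\<And>l. l \<in> {1..<s} \<Longrightarrow> y (Inl (i + l)) = 0"
  shows "real s powr \<alpha> * detour_bound k y i (i + s) \<le> hop_cost k \<alpha> R y i"
proof -
  have nn: "0 \<le> real s powr \<alpha> * hop_term k y i s" for s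
    by (intro mult_nonneg_nonneg hop_term_nonneg[where y = y] assms(1)) simp
  have "real s powr \<alpha> * detour_bound k y i (i + s) = real s powr \<alpha> * hop_term k y i s"
    using assms(3,4) by (simp add: hop_term_def)
  also have "\<dots> \<le> hop_cost k \<alpha> R y i"
    unfolding hop_cost_def by (rule member_le_sum) (use assms(2) nn in auto)
  finally show ?thesis .
qed

section \<open>A path along good blocks\<close>

lemma path_time_Cons:
  "p \<noteq> [] \<Longrightarrow> path_time \<alpha> v w (x # p) = edge_time \<alpha> v w x (hd p) + path_time \<alpha> v w p"
proof -
  assume "p \<noteq> []"
  then obtain n where n: "length p = Suc n" by (cases p) auto
  show ?thesis
    using \<open>p \<noteq> []\<close>
    by (simp add: path_time_def n sum.lessThan_Suc_shift hd_conv_nth del: sum.lessThan_Suc)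
qed

text \<open>Along an increasing list of positions the path is automatically self-avoiding.\<close>

lemma passage_time_le_increasing_path:
  fixes u :: "nat \<Rightarrow> int ^ 'd"
  assumes "inj u" "sorted_wrt (<) ps" "ps \<noteq> []"
  shows "passage_time \<alpha> v w (u (hd ps)) (u (last ps)) \<le> ereal (path_time \<alpha> v w (map u ps))"
  unfolding passage_time_def
proof (rule INF_lower)
  have "distinct ps" using assms(2) by (simp add: strict_sorted_iff)
  then show "map u ps \<in> paths (u (hd ps)) (u (last ps))"
    using assms(1,3) by (auto simp: paths_def distinct_map inj_on_def hd_map last_map inj_def)
qed

lemma edge_time_le:
  fixes u :: "nat \<Rightarrow> int ^ 'd"
  assumes "l1_norm (u a - u b) \<le> int (D * (b - a))" "D * (b - a) \<le> B" "\<alpha> > 0"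
    and "0 < \<delta>\<^sub>1" "\<delta>\<^sub>1 \<le> v (u a)" "0 < \<delta>\<^sub>2" "\<delta>\<^sub>2 \<le> v (u b)"
    and "0 \<le> w {u a, u b}"
  shows "edge_time \<alpha> v w (u a) (u b) \<le> real B powr \<alpha> * w {u a, u b} / (\<delta>\<^sub>1 * \<delta>\<^sub>2)"
proof -
  have "0 \<le> l1_norm (u a - u b)" by (simp add: l1_norm_def sum_nonneg)
  moreover have "l1_norm (u a - u b) \<le> int B" using assms(1,2) by linarith
  ultimately have "real_of_int (l1_norm (u a - u b)) powr \<alpha> \<le> real B powr \<alpha>"
    using assms(3) by (intro powr_mono2) auto
  then show ?thesis
    unfolding edge_time_def using assms
    by (intro frac_le mult_right_mono mult_mono mult_nonneg_nonneg mult_pos_pos) auto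
qed

text \<open>The path runs from \<open>u 0\<close> to the first good hub, from each good hub through a cheap intermediate
  stop of the same block to the next good hub, and from the last good hub among the first \<open>m\<close> blocks
  to \<open>u N\<close>. The window condition bounds every leap by \<open>R\<close> blocks, so that the hop costs see it, and
  bounds the lengths of the two end edges. At the ends only the lower bound \<open>\<epsilon>\<close> for the weight is
  available.\<close>

lemma chain_passage_time:
  fixes u :: "nat \<Rightarrow> int ^ 'd" and y :: "nat + nat \<times> nat \<Rightarrow> real"
  assumes inj: "inj u"
    and l1: "\<And>a b. a \<le> b \<Longrightarrow> l1_norm (u a - u b) \<le> int (D * (b - a))"
    and pos: "0 < \<alpha>" "1 \<le> k" "0 < \<delta>" "0 < \<epsilon>"
    and noise: "\<And>a b. a < b \<Longrightarrow> 0 \<le> w {u a, u b}"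
    and y_noise: "\<And>a b. a < b \<Longrightarrow> y (Inr (a, b)) = w {u a, u b}"
    and y_01: "\<And>i. y (Inl i) \<in> {0, 1}"
    and good: "\<And>i r. y (Inl i) = 1 \<Longrightarrow> r \<le> k \<Longrightarrow> \<delta> \<le> v (u (hub k i + r))"
    and R: "1 \<le> R" "R \<le> m"
    and window: "\<And>i. i + R \<le> m \<Longrightarrow> \<exists>l\<in>{i..<i + R}. y (Inl l) = 1"
    and N: "m * (k + 1) < N" "N \<le> (m + 1) * (k + 1)"
    and ends: "\<epsilon> \<le> v (u 0)" "\<epsilon> \<le> v (u N)"
    and t_first: "\<And>j. j < R \<Longrightarrow> w {u 0, u (hub k j)} \<le> t"
    and t_last: "\<And>j. m - R \<le> j \<Longrightarrow> j < m \<Longrightarrow> w {u (hub k j), u N} \<le> t"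
  shows "passage_time \<alpha> v w (u 0) (u N) \<le> ereal (
     real (D * (k + 1)) powr \<alpha> / \<delta>\<^sup>2 * (\<Sum>i<m. hop_cost k \<alpha> R y i)
     + 2 * (real (D * ((R + 1) * (k + 1))) powr \<alpha> * t / (\<epsilon> * \<delta>)))"
proof -
  define A where "A = real (D * (k + 1)) powr \<alpha> / \<delta>\<^sup>2"
  define E where "E = real (D * ((R + 1) * (k + 1))) powr \<alpha> * t / (\<epsilon> * \<delta>)"
  define G where "G = {i. i < m \<and> y (Inl i) = 1}"
  define T where "T ps = path_time \<alpha> v w (map u ps)" for ps
  have T_Cons: "T (a # ps) = edge_time \<alpha> v w (u a) (u (hd ps)) + T ps" if "ps \<noteq> []" for a ps
    using that by (simp add: T_def path_time_Cons hd_map)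
  have T_single: "T [a] = 0" for a by (simp add: T_def path_time_def)
  have A0: "0 \<le> A" by (simp add: A_def)
  have cost0: "0 \<le> hop_cost k \<alpha> R y i" for i
    by (rule hop_cost_nonneg) (rule y_01)
  have finG: "finite G" by (simp add: G_def)
  obtain a\<^sub>0 where a0: "a\<^sub>0 < R" "a\<^sub>0 \<in> G" using window[of 0] R by (auto simp: G_def)
  define b where "b = Max G"
  have bG: "b \<in> G" using finG a0 unfolding b_def by (intro Max_in) auto
  have b_max: "i \<le> b" if "i \<in> G" for i using that finG by (simp add: b_def)
  have b: "m - R \<le> b" "b < m"
  proof -
    obtain l where "l \<in> {m - R..<m - R + R}" "y (Inl l) = 1" using window[of "m - R"] R by auto
    then show "m - R \<le> b" using b_max[of l] R by (auto simp: G_def)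
  qed (use bG in \<open>simp add: G_def\<close>)
  have v_hub: "\<delta> \<le> v (u (hub k i))" if "i \<in> G" for i
    using good[of i 0] that by (simp add: G_def)
  have hub_b: "hub k b < N" "N - hub k b \<le> (R + 1) * (k + 1)"
  proof -
    have "(b + 1) * (k + 1) \<le> m * (k + 1)" using b by (intro mult_right_mono) auto
    then show "hub k b < N" using N pos(2) by (simp add: hub_def)
    have "(m + 1) * (k + 1) \<le> (R + 1 + b) * (k + 1)" using b by (intro mult_right_mono) auto
    then show "N - hub k b \<le> (R + 1) * (k + 1)" using N by (simp add: hub_def algebra_simps)
  qed
  have last_edge: "edge_time \<alpha> v w (u (hub k b)) (u N) \<le> E"
  proof -
    have "edge_time \<alpha> v w (u (hub k b)) (u N)
        \<le> real (D * ((R + 1) * (k + 1))) powr \<alpha> * w {u (hub k b), u N} / (\<delta> * \<epsilon>)"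
      using hub_b pos v_hub[OF bG] ends noise[OF hub_b(1)]
      by (intro edge_time_le[where D = D] l1 mult_left_mono) auto
    also have "\<dots> \<le> real (D * ((R + 1) * (k + 1))) powr \<alpha> * t / (\<delta> * \<epsilon>)"
      using t_last[OF b] pos by (intro divide_right_mono mult_left_mono) auto
    finally show ?thesis by (simp add: E_def mult.commute)
  qed
  \<comment> \<open>The path is built backwards from \<open>N\<close>; the induction runs over the good block \<open>a\<close> at which it starts.\<close>
  have chain: "\<exists>ps. ps \<noteq> [] \<and> sorted_wrt (<) ps \<and> hd ps = hub k a \<and> last ps = N \<and>
      T ps \<le> A * (\<Sum>i\<in>{a..<b}. hop_cost k \<alpha> R y i) + E" if "a \<in> G" for a
    using that
  proof (induction "b - a" arbitrary: a rule: less_induct)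
    case less
    note a = \<open>a \<in> G\<close>
    show ?case
    proof (cases "a = b")
      case True
      then show ?thesis
        using hub_b last_edge by (intro exI[of _ "[hub k b, N]"]) (simp add: T_Cons T_single)
    next
      case False
      then have ab: "a < b" using b_max[OF a] by simp
      define a' where "a' = (LEAST i. a < i \<and> i \<in> G)"
      have a': "a < a'" "a' \<in> G" using LeastI[of "\<lambda>i. a < i \<and> i \<in> G" b] ab bG by (auto simp: a'_def)
      have least: "i \<notin> G" if "a < i" "i < a'" for i
        using not_less_Least[of i "\<lambda>i. a < i \<and> i \<in> G"] that by (auto simp: a'_def)
      have a'b: "a' \<le> b" by (rule b_max[OF a'(2)])
      define s where "s = a' - a"
      have a's: "a' = a + s" using a' by (simp add: s_def)
      have s: "s \<in> {1..R}"
      proof -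
        have "s \<le> R"
        proof (rule ccontr)
          assume "\<not> s \<le> R"
          then have "a + 1 + R \<le> a'" using a' by (simp add: s_def)
          then show False
            using window[of "a + 1"] least a'b b by (fastforce simp: G_def)
        qed
        then show ?thesis using a' by (simp add: s_def)
      qed
      have zero: "y (Inl (a + l)) = 0" if "l \<in> {1..<s}" for l
        using least[of "a + l"] y_01[of "a + l"] that a'b b by (auto simp: a's G_def)
      have hop: "real s powr \<alpha> * detour_bound k y a (a + s) \<le> hop_cost k \<alpha> R y a"
        by (rule hop_cost_ge_next[where y = y, OF _ s _ zero]) (use a' y_01 in \<open>simp_all add: a's G_def\<close>)
      have "b - a' < b - a" using a' ab by simp
      from less.hyps[OF this a'(2)]
      obtain ps where ps: "ps \<noteq> []" "sorted_wrt (<) ps" "hd ps = hub k a'" "last ps = N"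
        "T ps \<le> A * (\<Sum>i\<in>{a'..<b}. hop_cost k \<alpha> R y i) + E"
        by blast
      have lt: "hub k a + k < hub k a'" using a'(1) by (rule hub_mono)
      obtain r where r: "r \<in> {1..k}" and cheap:
        "y (Inr (hub k a, hub k a + r)) + y (Inr (hub k a + r, hub k a')) \<le> detour_bound k y a a'"
        using cheap_detour[OF pos(2), of "\<lambda>r. y (Inr (hub k a, hub k a + r))" "\<lambda>r. y (Inr (hub k a + r, hub k a'))"]
          noise y_noise lt by (auto simp: detour_bound_def)
      define c where "c = hub k a + r"
      have c: "hub k a < c" "c < hub k a'" using r lt by (auto simp: c_def)
      have vc: "\<delta> \<le> v (u c)" using good[of a r] a r by (auto simp: c_def G_def)
      have diff: "hub k a' - hub k a = s * (k + 1)"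
        using a'(1) by (simp add: hub_def a's add_mult_distrib)
      have len: "c - hub k a \<le> s * (k + 1)" "hub k a' - c \<le> s * (k + 1)" using diff c by auto
      define B where "B = real (D * (s * (k + 1))) powr \<alpha> / \<delta>\<^sup>2"
      have e1: "edge_time \<alpha> v w (u (hub k a)) (u c) \<le> B * y (Inr (hub k a, c))"
        using edge_time_le[where u = u and w = w and v = v and D = D and B = "D * (s * (k + 1))" and a = "hub k a" and b = c
            and \<alpha> = \<alpha> and \<delta>\<^sub>1 = \<delta> and \<delta>\<^sub>2 = \<delta>] l1 len c pos v_hub[OF a] vc noise[OF c(1)] y_noise[OF c(1)]
        by (simp add: B_def power2_eq_square)
      have e2: "edge_time \<alpha> v w (u c) (u (hub k a')) \<le> B * y (Inr (c, hub k a'))"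
        using edge_time_le[where u = u and w = w and v = v and D = D and B = "D * (s * (k + 1))" and a = c and b = "hub k a'"
            and \<alpha> = \<alpha> and \<delta>\<^sub>1 = \<delta> and \<delta>\<^sub>2 = \<delta>] l1 len c pos v_hub[OF a'(2)] vc noise[OF c(2)] y_noise[OF c(2)]
        by (simp add: B_def power2_eq_square)
      have "real (D * (s * (k + 1))) = real (D * (k + 1)) * real s" by (simp add: algebra_simps)
      then have B: "B = A * real s powr \<alpha>"
        unfolding B_def A_def by (simp add: powr_mult del: of_nat_mult of_nat_add of_nat_Suc)
      have "edge_time \<alpha> v w (u (hub k a)) (u c) + edge_time \<alpha> v w (u c) (u (hub k a'))
          \<le> B * (y (Inr (hub k a, c)) + y (Inr (c, hub k a')))"
        using e1 e2 by (simp add: distrib_left)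
      also have "\<dots> \<le> B * detour_bound k y a a'"
        using cheap by (intro mult_left_mono) (simp_all add: c_def B_def)
      also have "\<dots> \<le> A * hop_cost k \<alpha> R y a"
        unfolding B using mult_left_mono[OF hop A0] by (simp add: a's mult.assoc)
      finally have "T (hub k a # c # ps) \<le> A * hop_cost k \<alpha> R y a + (A * (\<Sum>i\<in>{a'..<b}. hop_cost k \<alpha> R y i) + E)"
        using ps by (simp add: T_Cons)
      also have "\<dots> = A * (\<Sum>i\<in>insert a {a'..<b}. hop_cost k \<alpha> R y i) + E"
        using a' by (simp add: distrib_left)
      also have "\<dots> \<le> A * (\<Sum>i\<in>{a..<b}. hop_cost k \<alpha> R y i) + E"
        using A0 cost0 a' ab by (intro add_right_mono mult_left_mono sum_mono2) auto
      finally have "T (hub k a # c # ps) \<le> A * (\<Sum>i\<in>{a..<b}. hop_cost k \<alpha> R y i) + E" .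
      moreover have "sorted_wrt (<) (hub k a # c # ps)"
        using ps c by (cases ps) auto
      ultimately show ?thesis using ps by (intro exI[of _ "hub k a # c # ps"]) auto
    qed
  qed
  obtain ps where ps: "ps \<noteq> []" "sorted_wrt (<) ps" "hd ps = hub k a\<^sub>0" "last ps = N"
    "T ps \<le> A * (\<Sum>i\<in>{a\<^sub>0..<b}. hop_cost k \<alpha> R y i) + E"
    using chain[OF a0(2)] by blast
  have hub_a0: "0 < hub k a\<^sub>0" "hub k a\<^sub>0 \<le> (R + 1) * (k + 1)"
    using mult_right_mono[of a\<^sub>0 R "k + 1"] a0 by (auto simp: hub_def)
  have "edge_time \<alpha> v w (u 0) (u (hub k a\<^sub>0))
      \<le> real (D * ((R + 1) * (k + 1))) powr \<alpha> * w {u 0, u (hub k a\<^sub>0)} / (\<epsilon> * \<delta>)"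
    using hub_a0 pos v_hub[OF a0(2)] ends noise[OF hub_a0(1)]
    by (intro edge_time_le[where D = D] l1 mult_left_mono) auto
  also have "\<dots> \<le> E"
    unfolding E_def using t_first[OF a0(1)] pos by (intro divide_right_mono mult_left_mono) auto
  finally have "T (0 # ps) \<le> A * (\<Sum>i\<in>{a\<^sub>0..<b}. hop_cost k \<alpha> R y i) + 2 * E"
    using ps by (simp add: T_Cons)
  also have "\<dots> \<le> A * (\<Sum>i<m. hop_cost k \<alpha> R y i) + 2 * E"
    using A0 cost0 b by (intro add_right_mono mult_left_mono sum_mono2) auto
  finally have le: "T (0 # ps) \<le> A * (\<Sum>i<m. hop_cost k \<alpha> R y i) + 2 * E" .
  have "sorted_wrt (<) (0 # ps)"
    using ps hub_a0 by (cases ps) auto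
  from passage_time_le_increasing_path[OF inj this, of \<alpha> v w] 
  have "passage_time \<alpha> v w (u 0) (u N) \<le> ereal (T (0 # ps))"
    using ps by (simp add: T_def)
  also have "\<dots> \<le> ereal (A * (\<Sum>i<m. hop_cost k \<alpha> R y i) + 2 * E)" using le by simp
  finally show ?thesis by (simp only: A_def E_def)
qed

section \<open>Deviations of the hop costs\<close>

text \<open>A quantitative weak law for \<open>R\<close>-dependent variables: only the at most \<open>2 R m\<close> pairs at distance
  less than \<open>R\<close> contribute to the variance of the sum, each at most \<open>K\<close>, and the mean of each
  variable is at most \<open>K + 1\<close>. Chebyshev's inequality does the rest.\<close>

lemma (in prob_space) local_dependence_deviation:
  fixes X :: "nat \<Rightarrow> 'a \<Rightarrow> real"
  assumes meas [measurable]: "\<And>i. X i \<in> borel_measurable M"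
    and nonneg: "\<And>i s. s \<in> space M \<Longrightarrow> 0 \<le> X i s"
    and sq: "\<And>i. integrable M (\<lambda>s. (X i s)\<^sup>2)"
    and K: "\<And>i. expectation (\<lambda>s. (X i s)\<^sup>2) \<le> K"
    and far: "\<And>i j. i + R \<le> j \<Longrightarrow> indep_var borel (X i) borel (X j)"
    and m: "m > 0"
  shows "prob {s \<in> space M. (\<Sum>i<m. X i s) > (K + 2) * real m} \<le> 2 * real R * K / real m"
proof -
  have K0: "0 \<le> K" using order_trans[OF Bochner_Integration.integral_nonneg K[of 0]] by simp
  have int [simp]: "integrable M (X i)" for i
    using square_integrable_imp_integrable[OF meas sq] .
  have amgm: "X i s * X j s \<le> ((X i s)\<^sup>2 + (X j s)\<^sup>2) / 2" for i j s
    using sum_squares_bound[of "X i s" "X j s"] by simp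
  have int2 [simp]: "integrable M (\<lambda>s. X i s * X j s)" for i j
    by (rule Bochner_Integration.integrable_bound[where f = "\<lambda>s. ((X i s)\<^sup>2 + (X j s)\<^sup>2) / 2"])
      (use sq nonneg amgm in \<open>auto intro!: AE_I2\<close>)
  define \<mu> where "\<mu> i = expectation (X i)" for i
  have \<mu>0: "0 \<le> \<mu> i" for i unfolding \<mu>_def by (intro integral_nonneg_AE AE_I2 nonneg)
  have \<mu>1: "\<mu> i \<le> K + 1" for i
  proof -
    have "\<mu> i \<le> expectation (\<lambda>s. (X i s)\<^sup>2 + 1)"
      unfolding \<mu>_def
    proof (rule integral_mono)
      fix s show "X i s \<le> (X i s)\<^sup>2 + 1"
        using sum_squares_bound[of "X i s" 1] zero_le_power2[of "X i s"] by (simp; linarith)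
    qed (use sq in auto)
    also have "\<dots> \<le> K + 1" using sq K[of i] by (simp add: prob_space)
    finally show ?thesis .
  qed
  have cov: "expectation (\<lambda>s. X i s * X j s)
      \<le> \<mu> i * \<mu> j + (if i < j + R \<and> j < i + R then K else 0)" for i j
  proof (cases "i < j + R \<and> j < i + R")
    case True
    have "expectation (\<lambda>s. X i s * X j s) \<le> expectation (\<lambda>s. ((X i s)\<^sup>2 + (X j s)\<^sup>2) / 2)"
      by (rule integral_mono) (use sq amgm in auto)
    also have "\<dots> \<le> K" using sq K[of i] K[of j] by simp
    finally show ?thesis using True \<mu>0[of i] \<mu>0[of j] by (simp add: add_increasing)
  next
    case False
    then consider "i + R \<le> j" | "j + R \<le> i" by linarith
    then have "expectation (\<lambda>s. X i s * X j s) = \<mu> i * \<mu> j"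
    proof cases
      case 1
      then show ?thesis using indep_var_lebesgue_integral[OF far int int] by (simp add: \<mu>_def)
    next
      case 2
      from indep_var_lebesgue_integral[OF far[OF 2] int int]
      show ?thesis by (simp add: \<mu>_def mult.commute)
    qed
    then show ?thesis using False by auto
  qed
  define S where "S s = (\<Sum>i<m. X i s)" for s
  have S_meas [measurable]: "S \<in> borel_measurable M" unfolding S_def[abs_def] by measurable
  have S2: "(\<lambda>s. (S s)\<^sup>2) = (\<lambda>s. \<Sum>i<m. \<Sum>j<m. X i s * X j s)"
    by (simp add: S_def power2_eq_square sum_product)
  have intS: "integrable M S" "integrable M (\<lambda>s. (S s)\<^sup>2)"
    unfolding S2 by (auto simp: S_def[abs_def])
  have ES: "expectation S = (\<Sum>i<m. \<mu> i)" by (simp add: S_def[abs_def] \<mu>_def)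
  have near: "(\<Sum>j<m. if i < j + R \<and> j < i + R then K else 0) \<le> 2 * real R * K" for i
  proof -
    have "(\<Sum>j<m. if i < j + R \<and> j < i + R then K else 0)
        = real (card {j\<in>{..<m}. i < j + R \<and> j < i + R}) * K"
      by (subst sum.inter_filter[symmetric]) auto
    also have "card {j\<in>{..<m}. i < j + R \<and> j < i + R} \<le> card {i + 1 - R..<i + R}"
      by (rule card_mono) auto
    then have "real (card {j\<in>{..<m}. i < j + R \<and> j < i + R}) * K \<le> 2 * real R * K"
      using K0 by (intro mult_right_mono) auto
    finally show ?thesis .
  qed
  have "variance S = (\<Sum>i<m. \<Sum>j<m. expectation (\<lambda>s. X i s * X j s)) - (\<Sum>i<m. \<mu> i)\<^sup>2"
  proof -
    have "variance S = expectation (\<lambda>s. (S s)\<^sup>2) - (expectation S)\<^sup>2"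
      by (rule variance_eq[OF intS])
    then show ?thesis unfolding ES S2 by simp
  qed
  also have "\<dots> \<le> (\<Sum>i<m. \<Sum>j<m. \<mu> i * \<mu> j + (if i < j + R \<and> j < i + R then K else 0)) - (\<Sum>i<m. \<mu> i)\<^sup>2"
    by (intro diff_right_mono sum_mono cov)
  also have "\<dots> = (\<Sum>i<m. \<Sum>j<m. (if i < j + R \<and> j < i + R then K else 0))"
    by (simp add: power2_eq_square sum_product sum.distrib)
  also have "\<dots> \<le> (\<Sum>i<m. 2 * real R * K)"
    by (intro sum_mono near)
  finally have var: "variance S \<le> real m * (2 * real R * K)" by simp
  have "expectation S \<le> (\<Sum>i<m. K + 1)" unfolding ES by (intro sum_mono \<mu>1)
  then have ES_le: "expectation S \<le> real m * (K + 1)" by simp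
  have "prob {s \<in> space M. S s > (K + 2) * real m} \<le> prob {s \<in> space M. \<bar>S s - expectation S\<bar> \<ge> real m}"
  proof (rule finite_measure_mono)
    show "{s \<in> space M. S s > (K + 2) * real m} \<subseteq> {s \<in> space M. \<bar>S s - expectation S\<bar> \<ge> real m}"
      using ES_le by (auto simp: algebra_simps)
  qed measurable
  also have "\<dots> \<le> variance S / (real m)\<^sup>2"
    using Chebyshev_inequality[OF S_meas intS(2), of "real m"] m by simp
  also have "\<dots> \<le> real m * (2 * real R * K) / (real m)\<^sup>2"
    by (intro divide_right_mono var) simp
  also have "\<dots> = 2 * real R * K / real m"
    using m by (simp add: power2_eq_square)
  finally show ?thesis by (simp add: S_def)
qed

text \<open>The one-dimensional model that remains on the ray: independent indicators of good blocks and
  independent noises on pairs of positions, listed in increasing order.\<close>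

locale line_model = prob_space M for M :: "'a measure" +
  fixes Y :: "nat + nat \<times> nat \<Rightarrow> 'a \<Rightarrow> real" and k :: nat and q \<beta> :: real
  assumes indep_Y: "indep_vars (\<lambda>_. borel) Y (UNIV <+> {(a, b). a < b})"
    and Y_01: "\<And>i s. Y (Inl i) s \<in> {0, 1}"
    and mean_Y: "\<And>i. expectation (Y (Inl i)) = q"
    and boost_integrable: "\<And>a b. a < b \<Longrightarrow> integrable M (\<lambda>s. (boost k (Y (Inr (a, b)) s))\<^sup>2)"
    and boost_moment: "\<And>a b. a < b \<Longrightarrow> expectation (\<lambda>s. (boost k (Y (Inr (a, b)) s))\<^sup>2) \<le> \<beta>"
begin

lemma Y_measurable: "j \<in> UNIV <+> {(a, b). a < b} \<Longrightarrow> Y j \<in> borel_measurable M"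
  using indep_Y by (auto simp: indep_vars_def2)

lemma Y_Inl_measurable [measurable]: "Y (Inl i) \<in> borel_measurable M"
  by (rule Y_measurable) auto

lemma integrable_Y: "integrable M (Y (Inl i))"
proof (rule integrable_const_bound[where B = 1])
  show "AE s in M. norm (Y (Inl i) s) \<le> 1"
  proof (rule AE_I2)
    fix s show "norm (Y (Inl i) s) \<le> 1" using Y_01[of i s] by auto
  qed
qed auto

lemma q_le_1: "0 \<le> q" "q \<le> 1"
proof -
  have "0 \<le> Y (Inl 0) s" "Y (Inl 0) s \<le> 1" for s using Y_01[of 0 s] by auto
  then show "0 \<le> q" "q \<le> 1"
    using integral_nonneg_AE[of "Y (Inl 0)" M] integral_mono[OF integrable_Y, of "\<lambda>_. 1" 0]
    by (simp_all add: mean_Y prob_space)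
qed

lemma expectation_prod:
  assumes J: "finite J" "J \<subseteq> UNIV <+> {(a, b). a < b}"
    and f: "\<And>j. f j \<in> borel_measurable borel"
    and int: "\<And>j. j \<in> J \<Longrightarrow> integrable M (\<lambda>s. f j (Y j s) :: real)"
  shows "integrable M (\<lambda>s. \<Prod>j\<in>J. f j (Y j s))"
    and "expectation (\<lambda>s. \<Prod>j\<in>J. f j (Y j s)) = (\<Prod>j\<in>J. expectation (\<lambda>s. f j (Y j s)))"
proof -
  have "indep_vars (\<lambda>_. borel) (\<lambda>j s. f j (Y j s)) J"
    by (rule indep_vars_compose2[OF indep_vars_subset[OF indep_Y J(2)]]) (use f in auto)
  then show "integrable M (\<lambda>s. \<Prod>j\<in>J. f j (Y j s))"
    and "expectation (\<lambda>s. \<Prod>j\<in>J. f j (Y j s)) = (\<Prod>j\<in>J. expectation (\<lambda>s. f j (Y j s)))"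
    using indep_vars_integrable[OF J(1)] indep_vars_lebesgue_integral[OF J(1)] int by auto
qed

lemma prob_all_bad:
  "prob {s \<in> space M. \<forall>l\<in>{i..<i + R}. Y (Inl l) s = 0} = (1 - q) ^ R"
proof -
  define J :: "(nat + nat \<times> nat) set" where "J = Inl ` {i..<i + R}"
  have "prob {s \<in> space M. \<forall>l\<in>{i..<i + R}. Y (Inl l) s = 0}
      = expectation (indicator {s \<in> space M. \<forall>l\<in>{i..<i + R}. Y (Inl l) s = 0})"
    by simp
  also have "\<dots> = expectation (\<lambda>s. \<Prod>j\<in>J. 1 - Y j s)"
  proof (rule Bochner_Integration.integral_cong)
    fix s assume s: "s \<in> space M"
    have "(\<Prod>l\<in>{i..<i + R}. 1 - Y (Inl l) s) = of_bool (\<forall>l\<in>{i..<i + R}. Y (Inl l) s = 0)"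
    proof (cases "\<forall>l\<in>{i..<i + R}. Y (Inl l) s = 0")
      case False
      then obtain l where "l \<in> {i..<i + R}" "Y (Inl l) s = 1" using Y_01 by blast
      then show ?thesis using False by (auto intro!: prod_zero)
    qed simp
    then show "indicator {s \<in> space M. \<forall>l\<in>{i..<i + R}. Y (Inl l) s = 0} s = (\<Prod>j\<in>J. 1 - Y j s)"
      using s by (simp add: J_def prod.reindex indicator_def)
  qed simp
  also have "\<dots> = (\<Prod>j\<in>J. expectation (\<lambda>s. 1 - Y j s))"
    by (rule expectation_prod(2)[where f = "\<lambda>_ y. 1 - y"]) (auto simp: J_def integrable_Y)
  also have "\<dots> = (1 - q) ^ R"
    using integrable_Y by (simp add: J_def prod.reindex mean_Y prob_space)
  finally show ?thesis .
qed

definition hop_edges :: "nat \<Rightarrow> nat \<Rightarrow> (nat \<times> nat) set" where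
  "hop_edges i j = (\<lambda>r. (hub k i, hub k i + r)) ` {1..k} \<union> (\<lambda>r. (hub k i + r, hub k j)) ` {1..k}"

text \<open>The blocks and pairs that occur in \<open>hop_term\<close> are pairwise different, so that its defining product
  can be read as one product over a set of independent entries.\<close>

lemma prod_hop_index:
  fixes G :: "nat + nat \<times> nat \<Rightarrow> real"
  assumes "s \<ge> 1"
  shows "prod G (Inl ` {i + 1..i + s} \<union> Inr ` hop_edges i (i + s)) =
    (\<Prod>l\<in>{1..<s}. G (Inl (i + l))) * G (Inl (i + s)) *
    (\<Prod>r\<in>{1..k}. G (Inr (hub k i, hub k i + r)) * G (Inr (hub k i + r, hub k (i + s))))"
proof -
  have "prod G (Inl ` {i + 1..i + s}) = (\<Prod>l\<in>{i + 1..i + s}. G (Inl l))"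
    by (simp add: prod.reindex)
  also have "\<dots> = (\<Prod>l\<in>{1..s}. G (Inl (i + l)))"
    by (rule prod.reindex_bij_witness[where i = "\<lambda>l. i + l" and j = "\<lambda>l. l - i"]) auto
  also have "{1..s} = insert s {1..<s}" using assms by auto
  also have "(\<Prod>l\<in>insert s {1..<s}. G (Inl (i + l))) = (\<Prod>l\<in>{1..<s}. G (Inl (i + l))) * G (Inl (i + s))"
    by (simp add: mult.commute)
  finally have 1: "prod G (Inl ` {i + 1..i + s}) = (\<Prod>l\<in>{1..<s}. G (Inl (i + l))) * G (Inl (i + s))" .
  have "prod G (Inr ` hop_edges i (i + s)) = (\<Prod>e\<in>hop_edges i (i + s). G (Inr e))"
    by (simp add: prod.reindex)
  also have "\<dots> = (\<Prod>e\<in>(\<lambda>r. (hub k i, hub k i + r)) ` {1..k}. G (Inr e)) *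
      (\<Prod>e\<in>(\<lambda>r. (hub k i + r, hub k (i + s))) ` {1..k}. G (Inr e))"
    unfolding hop_edges_def by (rule prod.union_disjoint) auto
  also have "\<dots> = (\<Prod>r\<in>{1..k}. G (Inr (hub k i, hub k i + r)) * G (Inr (hub k i + r, hub k (i + s))))"
    by (simp add: prod.reindex inj_on_def prod.distrib)
  finally have 2: "prod G (Inr ` hop_edges i (i + s)) = \<dots>" .
  have "prod G (Inl ` {i + 1..i + s} \<union> Inr ` hop_edges i (i + s)) =
      prod G (Inl ` {i + 1..i + s}) * prod G (Inr ` hop_edges i (i + s))"
    by (rule prod.union_disjoint) (auto simp: hop_edges_def)
  then show ?thesis using 1 2 by simp
qed

text \<open>The factor \<open>(1 - q) ^ (s - 1)\<close> comes from the \<open>s - 1\<close> bad blocks that are leapt over, and one factor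
  \<open>\<beta>\<close> from each of the \<open>2 * k\<close> noises.\<close>

lemma hop_term_second_moment:
  assumes "s \<ge> 1"
  shows "integrable M (\<lambda>x. (hop_term k (\<lambda>j. Y j x) i s)\<^sup>2)" (is ?int)
    and "expectation (\<lambda>x. (hop_term k (\<lambda>j. Y j x) i s)\<^sup>2) \<le> (1 - q) ^ (s - 1) * \<beta> ^ (2 * k)" (is ?le)
proof -
  define J where "J = Inl ` {i + 1..i + s} \<union> Inr ` hop_edges i (i + s)"
  define f :: "nat + nat \<times> nat \<Rightarrow> real \<Rightarrow> real" where
    "f j y = (case j of Inl l \<Rightarrow> if l = i + s then y\<^sup>2 else (1 - y)\<^sup>2 | Inr _ \<Rightarrow> (boost k y)\<^sup>2)" for j y
  have lt: "hub k i + k < hub k (i + s)" using assms by (intro hub_mono) simp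
  have J: "finite J" "J \<subseteq> UNIV <+> {(a, b). a < b}"
    using lt by (auto simp: J_def hop_edges_def)
  have fm: "f j \<in> borel_measurable borel" for j
    by (cases j) (auto simp: f_def[abs_def])
  have sq: "(Y (Inl l) x)\<^sup>2 = Y (Inl l) x" "(1 - Y (Inl l) x)\<^sup>2 = 1 - Y (Inl l) x" for l x
    using Y_01[of l x] by auto
  have int: "integrable M (\<lambda>x. f j (Y j x))" if "j \<in> J" for j
  proof (cases j)
    case (Inl l)
    then show ?thesis
      by (cases "l = i + s") (simp_all add: f_def sq integrable_Y)
  next
    case (Inr e)
    then show ?thesis
      using that lt boost_integrable by (auto simp: f_def J_def hop_edges_def)
  qed
  have eq: "(hop_term k (\<lambda>j. Y j x) i s)\<^sup>2 = (\<Prod>j\<in>J. f j (Y j x))" for x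
    unfolding J_def prod_hop_index[OF assms]
    by (simp add: hop_term_def detour_bound_def f_def power_mult_distrib prod_power_distrib)
  show ?int unfolding eq by (rule expectation_prod(1)[OF J fm int])
  have bnd: "0 \<le> expectation (\<lambda>x. (boost k (Y (Inr e) x))\<^sup>2)" "fst e < snd e \<Longrightarrow> expectation (\<lambda>x. (boost k (Y (Inr e) x))\<^sup>2) \<le> \<beta>" for e
    using boost_moment[of "fst e" "snd e"] by auto
  have \<beta>0: "0 \<le> \<beta>" using order_trans[OF bnd(1) bnd(2), of "(0, 1)"] by simp
  have "expectation (\<lambda>x. (hop_term k (\<lambda>j. Y j x) i s)\<^sup>2) = (\<Prod>j\<in>J. expectation (\<lambda>x. f j (Y j x)))"
    unfolding eq by (rule expectation_prod(2)[OF J fm int])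
  also have "\<dots> = (1 - q) ^ (s - 1) * q * (\<Prod>r\<in>{1..k}.
      expectation (\<lambda>x. (boost k (Y (Inr (hub k i, hub k i + r)) x))\<^sup>2) *
      expectation (\<lambda>x. (boost k (Y (Inr (hub k i + r, hub k (i + s))) x))\<^sup>2))"
    unfolding J_def prod_hop_index[OF assms]
    using integrable_Y by (simp add: f_def sq mean_Y prob_space)
  also have "\<dots> \<le> (1 - q) ^ (s - 1) * 1 * (\<Prod>r\<in>{1..k}. \<beta> * \<beta>)"
    using q_le_1 lt \<beta>0
    by (intro mult_mono prod_mono conjI mult_nonneg_nonneg bnd prod_nonneg) (auto intro!: bnd)
  also have "\<dots> = (1 - q) ^ (s - 1) * \<beta> ^ (2 * k)"
    by (simp add: power_mult power2_eq_square)
  finally show ?le .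
qed

text \<open>At most one block is the first good block after \<open>i\<close>, so all mixed terms of the square vanish.\<close>

lemma hop_cost_square:
  "(hop_cost k \<alpha> R (\<lambda>j. Y j x) i)\<^sup>2
    = (\<Sum>s\<in>{1..R}. (real s powr \<alpha>)\<^sup>2 * (hop_term k (\<lambda>j. Y j x) i s)\<^sup>2)"
proof -
  define a where "a s = real s powr \<alpha> * hop_term k (\<lambda>j. Y j x) i s" for s
  have zero: "a s * a t = 0" if "1 \<le> s" "s < t" for s t
  proof -
    have "Y (Inl (i + s)) x = 0 \<or> 1 - Y (Inl (i + s)) x = 0" using Y_01[of "i + s" x] by auto
    then show ?thesis
    proof
      assume "1 - Y (Inl (i + s)) x = 0"
      then have "(\<Prod>l\<in>{1..<t}. 1 - Y (Inl (i + l)) x) = 0" using that by (intro prod_zero) auto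
      then show ?thesis by (simp add: a_def hop_term_def)
    qed (simp add: a_def hop_term_def)
  qed
  have "(\<Sum>t\<in>{1..R}. a s * a t) = (a s)\<^sup>2" if "s \<in> {1..R}" for s
  proof -
    have "(\<Sum>t\<in>{1..R}. a s * a t) = (\<Sum>t\<in>{s}. a s * a t)"
    proof (rule sum.mono_neutral_right)
      show "\<forall>t\<in>{1..R} - {s}. a s * a t = 0"
        using zero that by (metis DiffD1 DiffD2 atLeastAtMost_iff insertI1 linorder_less_linear mult.commute)
    qed (use that in auto)
    then show ?thesis by (simp add: power2_eq_square)
  qed
  then have "(\<Sum>s\<in>{1..R}. a s)\<^sup>2 = (\<Sum>s\<in>{1..R}. (a s)\<^sup>2)"
    by (simp add: power2_eq_square[of "sum a _"] sum_product)
  then show ?thesis by (simp add: a_def hop_cost_def power_mult_distrib)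
qed

lemma hop_cost_second_moment:
  shows "integrable M (\<lambda>x. (hop_cost k \<alpha> R (\<lambda>j. Y j x) i)\<^sup>2)"
    and "expectation (\<lambda>x. (hop_cost k \<alpha> R (\<lambda>j. Y j x) i)\<^sup>2)
      \<le> \<beta> ^ (2 * k) * (\<Sum>s\<in>{1..R}. real s powr (2 * \<alpha>) * (1 - q) ^ (s - 1))"
proof -
  note int = hop_term_second_moment(1)
  show "integrable M (\<lambda>x. (hop_cost k \<alpha> R (\<lambda>j. Y j x) i)\<^sup>2)"
    unfolding hop_cost_square
    by (intro Bochner_Integration.integrable_sum integrable_mult_right) (auto intro: int)
  have "expectation (\<lambda>x. (hop_cost k \<alpha> R (\<lambda>j. Y j x) i)\<^sup>2)
      = (\<Sum>s\<in>{1..R}. (real s powr \<alpha>)\<^sup>2 * expectation (\<lambda>x. (hop_term k (\<lambda>j. Y j x) i s)\<^sup>2))"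
    unfolding hop_cost_square by (subst Bochner_Integration.integral_sum) (auto simp: int)
  also have "\<dots> \<le> (\<Sum>s\<in>{1..R}. (real s powr \<alpha>)\<^sup>2 * ((1 - q) ^ (s - 1) * \<beta> ^ (2 * k)))"
    by (intro sum_mono mult_left_mono hop_term_second_moment(2)) auto
  also have "\<dots> = \<beta> ^ (2 * k) * (\<Sum>s\<in>{1..R}. real s powr (2 * \<alpha>) * (1 - q) ^ (s - 1))"
    by (simp add: sum_distrib_left powr_power mult_ac)
  finally show "expectation (\<lambda>x. (hop_cost k \<alpha> R (\<lambda>j. Y j x) i)\<^sup>2) \<le> \<dots>" .
qed

text \<open>All noises in the cost of a hop from block \<open>i\<close> sit on pairs whose smaller position lies in block
  \<open>i\<close>. Noises are therefore never shared by two blocks, and indicators of good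
  blocks only at distance less than \<open>R\<close>.\<close>

definition hop_range :: "nat \<Rightarrow> nat \<Rightarrow> (nat + nat \<times> nat) set" where
  "hop_range R i = Inl ` {i + 1..i + R} \<union> Inr ` {(a, b). hub k i \<le> a \<and> a \<le> hub k i + k \<and> a < b}"

lemma hop_cost_measurable_PiM:
  "(\<lambda>y. hop_cost k \<alpha> R y i) \<in> borel_measurable (PiM (hop_range R i) (\<lambda>_. borel))"
proof -
  have comp: "(\<lambda>y. y j) \<in> borel_measurable (PiM (hop_range R i) (\<lambda>_. borel))"
    if "j \<in> hop_range R i" for j
    using measurable_component_singleton[OF that, of "\<lambda>_. borel"] by simp
  note compb = measurable_compose[OF comp borel_measurable_boost]
  have lt: "hub k i + k < hub k (i + s)" if "s \<ge> 1" for s using that by (intro hub_mono) simp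
  have 1: "Inl (i + l) \<in> hop_range R i" if "1 \<le> l" "l \<le> R" for l
    using that by (auto simp: hop_range_def)
  have 2: "Inr (hub k i, hub k i + r) \<in> hop_range R i" if "1 \<le> r" "r \<le> k" for r
    using that by (auto simp: hop_range_def)
  have 3: "Inr (hub k i + r, hub k (i + s)) \<in> hop_range R i" if "r \<le> k" "1 \<le> s" for r s
    using that lt[of s] by (auto simp: hop_range_def)
  show ?thesis
    unfolding hop_cost_def hop_term_def detour_bound_def
    by (intro borel_measurable_sum borel_measurable_times borel_measurable_prod
        borel_measurable_diff borel_measurable_const comp compb) (auto intro: 1 2 3)
qed

lemma hop_cost_eq_restrict:
  "hop_cost k \<alpha> R y i = hop_cost k \<alpha> R (restrict y (hop_range R i)) i"
proof -
  have lt: "hub k i + k < hub k (i + s)" if "s \<ge> 1" for s using that by (intro hub_mono) simp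
  have 1: "Inl (i + l) \<in> hop_range R i" if "l \<in> {1..R}" for l
    using that by (auto simp: hop_range_def)
  have 2: "Inr (hub k i, hub k i + r) \<in> hop_range R i" if "r \<in> {1..k}" for r
    using that by (auto simp: hop_range_def)
  have 3: "Inr (hub k i + r, hub k (i + s)) \<in> hop_range R i" if "r \<in> {1..k}" "s \<in> {1..R}" for r s
    using that lt[of s] by (auto simp: hop_range_def)
  show ?thesis
    unfolding hop_cost_def hop_term_def detour_bound_def
    by (intro sum.cong prod.cong refl arg_cong2[where f = "(*)"]) (auto simp: 1 2 3)
qed

lemma hop_range_subset: "hop_range R i \<subseteq> UNIV <+> {(a, b). a < b}"
  by (auto simp: hop_range_def)

lemma hop_cost_measurable: "(\<lambda>x. hop_cost k \<alpha> R (\<lambda>j. Y j x) i) \<in> borel_measurable M"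
proof -
  have "(\<lambda>x. restrict (\<lambda>j. Y j x) (hop_range R i)) \<in> measurable M (PiM (hop_range R i) (\<lambda>_. borel))"
    using Y_measurable hop_range_subset[of R i] by (intro measurable_restrict) auto
  from measurable_compose[OF this hop_cost_measurable_PiM[of \<alpha> R i]] show ?thesis
    by (simp flip: hop_cost_eq_restrict)
qed

lemma hop_cost_indep:
  assumes "i + R \<le> j" "R \<ge> 1"
  shows "indep_var borel (\<lambda>x. hop_cost k \<alpha> R (\<lambda>l. Y l x) i) borel (\<lambda>x. hop_cost k \<alpha> R (\<lambda>l. Y l x) j)"
proof -
  have "hub k i + k < hub k j" using assms by (intro hub_mono) simp
  then have "hop_range R i \<inter> hop_range R j = {}"
    using assms by (auto simp: hop_range_def)
  from indep_var_compose[OF indep_var_restrict[OF indep_Y this hop_range_subset hop_range_subset]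
      hop_cost_measurable_PiM[of \<alpha>] hop_cost_measurable_PiM[of \<alpha>]]
  show ?thesis by (simp add: comp_def flip: hop_cost_eq_restrict)
qed

end

text \<open>Gaps between good blocks have geometric tails, hence moments of every order.\<close>

lemma bounded_gap_moment:
  fixes q \<alpha> :: real
  assumes "0 < q" "q \<le> 1"
  shows "\<exists>K\<ge>0. \<forall>R. (\<Sum>s\<in>{1..R}. real s powr \<alpha> * (1 - q) ^ (s - 1)) \<le> K"
proof -
  define f where "f s = real s powr \<alpha> * exp (- q * (real s - 1))" for s :: nat
  have "f \<in> O(\<lambda>s. inverse (real s ^ 2))"
    unfolding f_def using assms by real_asymp
  moreover have "summable (\<lambda>s. norm (inverse (real s ^ 2)))"
    using inverse_power_summable[of 2, where ?'a = real] by simp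
  ultimately have sum: "summable f"
    by (rule summable_comparison_test_bigo[rotated])
  have "(\<Sum>s\<in>{1..R}. real s powr \<alpha> * (1 - q) ^ (s - 1)) \<le> suminf f" for R
  proof -
    have "(\<Sum>s\<in>{1..R}. real s powr \<alpha> * (1 - q) ^ (s - 1)) \<le> (\<Sum>s\<in>{1..R}. f s)"
    proof (intro sum_mono)
      fix s assume s: "s \<in> {1..R}"
      have "(1 - q) ^ (s - 1) \<le> exp (- q) ^ (s - 1)"
        using assms exp_ge_add_one_self[of "- q"] by (intro power_mono) auto
      also have "\<dots> = exp (- q * (real s - 1))"
        using s by (simp flip: exp_of_nat_mult add: of_nat_diff mult.commute)
      finally show "real s powr \<alpha> * (1 - q) ^ (s - 1) \<le> f s"
        unfolding f_def by (intro mult_left_mono) auto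
    qed
    also have "\<dots> \<le> suminf f" by (rule sum_le_suminf[OF sum]) (auto simp: f_def)
    finally show ?thesis .
  qed
  moreover have "suminf f \<ge> 0" by (rule suminf_nonneg[OF sum]) (simp add: f_def)
  ultimately show ?thesis by blast
qed

section \<open>The line model on a ray\<close>

context ilrfpp
begin

lemma V_measurable [measurable]: "V x \<in> borel_measurable M"
  using indep by (auto simp: indep_vars_def2 dest: bspec[of _ _ "Inl x"])

lemma noise_measurable: "e \<in> edges \<Longrightarrow> \<omega> e \<in> borel_measurable M"
  using indep by (auto simp: indep_vars_def2 dest: bspec[of _ _ "Inr e"])

lemma edge_in_edges: "inj u \<Longrightarrow> a < b \<Longrightarrow> {u a, u (b :: nat)} \<in> edges"
  using inj_eq[of u a b] unfolding edges_def by blast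

lemma prob_V_less: "prob {s \<in> space M. V x s < \<epsilon>} = measure \<mu>\<^sub>V {..<\<epsilon>}"
  unfolding law_V[of x, symmetric]
  by (subst measure_distr) (auto intro!: arg_cong[where f = prob])

lemma prob_space_\<mu>\<^sub>V: "prob_space \<mu>\<^sub>V"
  unfolding law_V[of 0, symmetric] by (rule prob_space_distr) simp

lemma ex_edge: "\<exists>e :: (int ^ 'd) set. e \<in> edges"
proof -
  have "{0, 1 :: int ^ 'd} \<in> edges" unfolding edges_def using zero_neq_one by blast
  then show ?thesis by blast
qed

lemma sets_\<mu>\<^sub>\<omega>: "sets \<mu>\<^sub>\<omega> = sets borel"
  using ex_edge law_noise by (metis sets_distr)

lemma prob_space_\<mu>\<^sub>\<omega>: "prob_space \<mu>\<^sub>\<omega>"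
  using ex_edge law_noise noise_measurable prob_space_distr by metis

text \<open>Markov's inequality for the moment of order \<open>\<zeta>\<close>.\<close>

lemma prob_noise_greater:
  assumes e: "e \<in> edges" and t: "t > 0"
  shows "prob {s \<in> space M. t < \<omega> e s} \<le> (\<integral>w. w powr \<zeta> \<partial>\<mu>\<^sub>\<omega>) / t powr \<zeta>"
proof -
  note [measurable] = noise_measurable[OF e]
  have int: "integrable M (\<lambda>s. \<omega> e s powr \<zeta>)"
    using noise_moment unfolding law_noise[OF e, symmetric] by (subst (asm) integrable_distr_eq) auto
  have "prob {s \<in> space M. t < \<omega> e s} \<le> prob {s \<in> space M. t powr \<zeta> \<le> \<omega> e s powr \<zeta>}"
    using t zeta_pos by (intro finite_measure_mono) (auto intro!: powr_mono2)
  also have "\<dots> \<le> (\<integral>s. \<omega> e s powr \<zeta> \<partial>M) / t powr \<zeta>"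
    by (rule integral_Markov_inequality_measure[OF int, where A = "{}"]) (use t in auto)
  also have "(\<integral>s. \<omega> e s powr \<zeta> \<partial>M) = (\<integral>w. w powr \<zeta> \<partial>\<mu>\<^sub>\<omega>)"
    unfolding law_noise[OF e, symmetric] by (subst integral_distr) auto
  finally show ?thesis .
qed

lemma AE_noise_nonneg: "AE s in M. \<forall>e\<in>edges. 0 \<le> \<omega> e s"
proof -
  have "countable (edges :: (int ^ 'd) set set)"
  proof (rule countable_subset)
    show "(edges :: (int ^ 'd) set set) \<subseteq> (\<lambda>(x, y). {x, y}) ` UNIV" by (auto simp: edges_def)
  qed simp
  moreover have "AE s in M. 0 \<le> \<omega> e s" if "e \<in> edges" for e
    using noise_nonneg noise_measurable[OF that]
    unfolding law_noise[OF that, symmetric] by (subst (asm) AE_distr_iff) auto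
  ultimately show ?thesis by (simp add: AE_ball_countable)
qed

text \<open>The square of \<open>boost k\<close> grows like the power \<open>2 / k\<close>, which \<open>\<zeta>\<close> dominates.\<close>

lemma boost_square_integrable:
  assumes "1 \<le> k" "2 / real k \<le> \<zeta>"
  shows "integrable \<mu>\<^sub>\<omega> (\<lambda>w. (boost k w)\<^sup>2)"
proof (rule Bochner_Integration.integrable_bound)
  interpret \<omega>: prob_space \<mu>\<^sub>\<omega> by (rule prob_space_\<mu>\<^sub>\<omega>)
  show "integrable \<mu>\<^sub>\<omega> (\<lambda>w. 4 + 2 * w powr \<zeta>)" using noise_moment by auto
  show "(\<lambda>w. (boost k w)\<^sup>2) \<in> borel_measurable \<mu>\<^sub>\<omega>"
    by (subst measurable_cong_sets[OF sets_\<mu>\<^sub>\<omega> refl]) measurable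
  have "(boost k w)\<^sup>2 \<le> 4 + 2 * w powr \<zeta>" for w
  proof -
    have "w powr (2 / real k) \<le> 1 + w powr \<zeta>"
    proof (cases "ln w \<ge> 0")
      case True
      then have "2 / real k * ln w \<le> \<zeta> * ln w" using assms by (intro mult_right_mono)
      then show ?thesis by (auto simp: powr_def add_increasing)
    next
      case False
      then have "2 / real k * ln w \<le> 0" by (simp add: mult_nonneg_nonpos divide_nonpos_nonneg)
      then show ?thesis by (auto simp: powr_def add_increasing2)
    qed
    moreover have "(w powr (1 / real k))\<^sup>2 = w powr (2 / real k)"
      by (simp add: power2_eq_square flip: powr_add)
    moreover have "2 * (w powr (1 / real k)) \<le> 1 + (w powr (1 / real k))\<^sup>2"
      using sum_squares_bound[of 1 "w powr (1 / real k)"] by simp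
    ultimately show ?thesis by (simp add: boost_def power2_sum)
  qed
  then show "AE w in \<mu>\<^sub>\<omega>. norm ((boost k w)\<^sup>2) \<le> norm (4 + 2 * w powr \<zeta>)"
    by (intro AE_I2) (simp add: abs_of_nonneg)
qed

definition line_vars :: "(nat \<Rightarrow> int ^ 'd) \<Rightarrow> nat \<Rightarrow> real \<Rightarrow> nat + nat \<times> nat \<Rightarrow> 'a \<Rightarrow> real" where
  "line_vars u k \<delta> j s = (case j of
     Inl i \<Rightarrow> (\<Prod>r\<in>{0..k}. indicator {\<delta>..} (V (u (hub k i + r)) s))
   | Inr (a, b) \<Rightarrow> \<omega> {u a, u b} s)"

lemma hub_inj:
  assumes "hub k i + r = hub k j + r'" "r \<le> k" "r' \<le> k"
  shows "i = j"
  using hub_mono[of i j k] hub_mono[of j i k] assms by (cases i j rule: linorder_cases) auto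

text \<open>Distinct blocks use disjoint sets of vertices, and distinct pairs of positions distinct edges, because
  \<open>u\<close> is injective. Grouping an independent family along a partition keeps it independent.\<close>

lemma line_model_line_vars:
  assumes u: "inj u" and k: "1 \<le> k" "2 / real k \<le> \<zeta>"
  shows "line_model M (line_vars u k \<delta>) k (measure \<mu>\<^sub>V {\<delta>..} ^ (k + 1)) (\<integral>w. (boost k w)\<^sup>2 \<partial>\<mu>\<^sub>\<omega>)"
proof
  let ?I = "UNIV <+> {(a, b). a < b} :: (nat + nat \<times> nat) set"
  define Z where "Z = case_sum V \<omega>"
  define W where "W i = (\<lambda>r. Inl (u (hub k i + r)) :: int ^ 'd + (int ^ 'd) set) ` {0..k}" for i
  \<comment> \<open>\<open>K j\<close> collects the weights and noises that determine the entry \<open>j\<close> of the line model, and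
    \<open>f j\<close> computes it from them.\<close>
  define K where "K j = (case j of Inl i \<Rightarrow> W i | Inr (a, b) \<Rightarrow> {Inr {u a, u b}})" for j
  define f where "f j g = (case j of
      Inl i \<Rightarrow> (\<Prod>r\<in>{0..k}. indicator {\<delta>..} (g (Inl (u (hub k i + r)))))
    | Inr (a, b) \<Rightarrow> g (Inr {u a, u b}))" for j and g :: "int ^ 'd + (int ^ 'd) set \<Rightarrow> real"
  have indepZ: "indep_vars (\<lambda>_. borel) Z (UNIV <+> edges)" unfolding Z_def by (rule indep)
  have "disjoint_family_on K ?I"
    unfolding disjoint_family_on_def
  proof (intro ballI impI)
    fix p p' assume I: "p \<in> ?I" "p' \<in> ?I" "p \<noteq> p'"
    show "K p \<inter> K p' = {}"
    proof (cases p; cases p')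
      fix i i' assume "p = Inl i" "p' = Inl i'"
      then show ?thesis using I u hub_inj by (fastforce simp: K_def W_def inj_def)
    next
      fix e e' assume ee: "p = Inr e" "p' = Inr e'"
      obtain a b a' b' where "e = (a, b)" "e' = (a', b')" by (cases e; cases e') auto
      then show ?thesis using I u ee by (auto simp: K_def doubleton_eq_iff inj_eq)
    qed (auto simp: K_def W_def split: prod.splits)
  qed
  moreover have "K p \<subseteq> UNIV <+> edges" if "p \<in> ?I" for p
    using that edge_in_edges[OF u] by (auto simp: K_def W_def)
  ultimately have "indep_vars (\<lambda>p. PiM (K p) (\<lambda>_. borel)) (\<lambda>p s. restrict (\<lambda>i. Z i s) (K p)) ?I"
    by (intro indep_vars_restrict[OF indepZ])
  moreover have "f p \<in> borel_measurable (PiM (K p) (\<lambda>_. borel))" for p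
  proof (cases p)
    case (Inl i)
    have "(\<lambda>g. g (Inl (u (hub k i + r)))) \<in> borel_measurable (PiM (K p) (\<lambda>_. borel))" if "r \<in> {0..k}" for r
      using that by (intro measurable_component_singleton) (auto simp: Inl K_def W_def)
    then show ?thesis unfolding f_def Inl sum.case
      by (intro borel_measurable_prod measurable_compose[OF _ borel_measurable_indicator]) (auto simp: Inl)
  next
    case (Inr e)
    obtain a b where e: "e = (a, b)" by (cases e)
    show ?thesis unfolding f_def Inr e sum.case prod.case
      by (intro measurable_component_singleton) (auto simp: Inr e K_def)
  qed
  ultimately have "indep_vars (\<lambda>_. borel) (\<lambda>p s. f p (restrict (\<lambda>i. Z i s) (K p))) ?I"
    by (rule indep_vars_compose2)
  moreover have "f p (restrict (\<lambda>i. Z i s) (K p)) = line_vars u k \<delta> p s" for p s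
    by (auto simp: f_def K_def W_def Z_def line_vars_def split: sum.splits intro!: prod.cong)
  ultimately show "indep_vars (\<lambda>_. borel) (line_vars u k \<delta>) ?I" by simp
  show "line_vars u k \<delta> (Inl i) s \<in> {0, 1}" for i s
  proof (cases "\<forall>r\<in>{0..k}. \<delta> \<le> V (u (hub k i + r)) s")
    case False
    then obtain r where "r \<in> {0..k}" "\<not> \<delta> \<le> V (u (hub k i + r)) s" by blast
    then have "line_vars u k \<delta> (Inl i) s = 0"
      by (auto simp: line_vars_def intro!: prod_zero bexI[of _ r])
    then show ?thesis by simp
  qed (simp add: line_vars_def)
  show "expectation (line_vars u k \<delta> (Inl i)) = measure \<mu>\<^sub>V {\<delta>..} ^ (k + 1)" for i
  proof -
    have ind: "indep_vars (\<lambda>_. borel) (\<lambda>z s. indicator {\<delta>..} (Z z s) :: real) (W i)"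
      by (rule indep_vars_compose2[OF indep_vars_subset[OF indepZ]]) (auto simp: W_def)
    have inj: "inj_on (\<lambda>r. Inl (u (hub k i + r)) :: int ^ 'd + (int ^ 'd) set) {0..k}"
      by (auto simp: inj_on_def inj_eq[OF u])
    have fin: "finite (W i)" by (simp add: W_def)
    have E: "expectation (\<lambda>s. indicator {\<delta>..} (V x s) :: real) = measure \<mu>\<^sub>V {\<delta>..}"
      and int: "integrable M (\<lambda>s. indicator {\<delta>..} (V x s) :: real)" for x
    proof -
      show "integrable M (\<lambda>s. indicator {\<delta>..} (V x s) :: real)"
        by (rule integrable_const_bound[where B = 1]) auto
      have "expectation (\<lambda>s. indicator {\<delta>..} (V x s) :: real) = (\<integral>v. indicator {\<delta>..} v \<partial>\<mu>\<^sub>V)"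
        unfolding law_V[of x, symmetric] by (subst integral_distr) auto
      also have "\<dots> = measure \<mu>\<^sub>V {\<delta>..}"
        using law_V[of x] by (metis Bochner_Integration.integral_indicator Int_UNIV_right Int_commute sets_distr space_borel space_distr)
      finally show "expectation (\<lambda>s. indicator {\<delta>..} (V x s) :: real) = measure \<mu>\<^sub>V {\<delta>..}" .
    qed
    have "expectation (line_vars u k \<delta> (Inl i)) = expectation (\<lambda>s. \<Prod>z\<in>W i. indicator {\<delta>..} (Z z s))"
      by (simp add: W_def prod.reindex[OF inj] line_vars_def[abs_def] Z_def)
    also have "\<dots> = (\<Prod>z\<in>W i. expectation (\<lambda>s. indicator {\<delta>..} (Z z s)))"
      by (rule indep_vars_lebesgue_integral[OF fin ind]) (auto simp: W_def Z_def int)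
    also have "\<dots> = measure \<mu>\<^sub>V {\<delta>..} ^ (k + 1)"
      by (simp add: W_def prod.reindex[OF inj] Z_def E)
    finally show ?thesis .
  qed
  fix a b :: nat assume ab: "a < b"
  note e = edge_in_edges[OF u ab]
  note [measurable] = noise_measurable[OF e]
  show "integrable M (\<lambda>s. (boost k (line_vars u k \<delta> (Inr (a, b)) s))\<^sup>2)"
    using boost_square_integrable[OF k] unfolding law_noise[OF e, symmetric] line_vars_def
    by (subst (asm) integrable_distr_eq) auto
  show "expectation (\<lambda>s. (boost k (line_vars u k \<delta> (Inr (a, b)) s))\<^sup>2) \<le> (\<integral>w. (boost k w)\<^sup>2 \<partial>\<mu>\<^sub>\<omega>)"
    unfolding law_noise[OF e, symmetric] line_vars_def
    by (subst integral_distr) auto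
qed

lemma line_vars_good:
  assumes "line_vars u k \<delta> (Inl i) s = 1" "r \<le> k"
  shows "\<delta> \<le> V (u (hub k i + r)) s"
proof (rule ccontr)
  assume "\<not> \<delta> \<le> V (u (hub k i + r)) s"
  then have "line_vars u k \<delta> (Inl i) s = 0"
    using assms(2) by (auto simp: line_vars_def intro!: prod_zero bexI[of _ r])
  then show False using assms(1) by simp
qed

end

section \<open>Deviations of the passage time\<close>

context ilrfpp
begin

text \<open>Outside five unlikely events the chain of good blocks is cheap. The events, with their
  contributions to the bound, are: a window of \<open>R\<close> bad blocks, a small weight at one of the two ends,
  a large noise between the start and one of the first \<open>R\<close> hubs, a large noise between one of the last
  \<open>R\<close> hubs and the end, and an untypically large sum of hop costs. Stating the bound for every
  threshold \<open>c\<close> above the typical cost spares a measurability argument for the passage time.\<close>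

lemma passage_time_deviation:
  fixes u :: "nat \<Rightarrow> int ^ 'd"
  assumes u: "inj u" "\<And>a b. a \<le> b \<Longrightarrow> l1_norm (u a - u b) \<le> int (D * (b - a))"
    and k: "1 \<le> k" "2 / real k \<le> \<zeta>"
    and q: "q = measure \<mu>\<^sub>V {\<delta>..} ^ (k + 1)" and \<beta>: "\<beta> = (\<integral>w. (boost k w)\<^sup>2 \<partial>\<mu>\<^sub>\<omega>)"
    and K: "\<And>R. \<beta> ^ (2 * k) * (\<Sum>s\<in>{1..R}. real s powr (2 * \<alpha>) * (1 - q) ^ (s - 1)) \<le> K"
    and pos: "0 < \<delta>" "0 < \<epsilon>" "0 < t"
    and R: "1 \<le> R" "R \<le> m"
    and N: "m * (k + 1) < N" "N \<le> (m + 1) * (k + 1)"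
    and c: "real (D * (k + 1)) powr \<alpha> / \<delta>\<^sup>2 * ((K + 2) * real m)
      + 2 * (real (D * ((R + 1) * (k + 1))) powr \<alpha> * t / (\<epsilon> * \<delta>)) \<le> c"
  shows "prob {s \<in> space M. passage_time \<alpha> (\<lambda>z. V z s) (\<lambda>e. \<omega> e s) (u 0) (u N) > ereal c}
    \<le> real m * (1 - q) ^ R + 2 * measure \<mu>\<^sub>V {..<\<epsilon>}
      + 2 * real R * ((\<integral>w. w powr \<zeta> \<partial>\<mu>\<^sub>\<omega>) / t powr \<zeta>) + 2 * real R * K / real m"
    (is "prob ?slow \<le> _")
proof -
  let ?Y = "line_vars u k \<delta>"
  interpret line_model M ?Y k q \<beta>
    unfolding q \<beta> by (rule line_model_line_vars[OF u(1) k])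
  let ?X = "\<lambda>i s. hop_cost k \<alpha> R (\<lambda>j. ?Y j s) i"
  let ?Z = "\<integral>w. w powr \<zeta> \<partial>\<mu>\<^sub>\<omega>"
  have X_meas: "?X i \<in> borel_measurable M" for i by (rule hop_cost_measurable)
  have hub_N: "hub k j < N" if "j < m" for j
  proof -
    have "(j + 1) * (k + 1) \<le> m * (k + 1)" using that by (intro mult_right_mono) auto
    then show ?thesis using N k by (simp add: hub_def)
  qed
  have e_first: "{u 0, u (hub k j)} \<in> edges" for j
    by (rule edge_in_edges[OF u(1)]) (simp add: hub_def)
  have e_last: "{u (hub k j), u N} \<in> edges" if "j < m" for j
    by (rule edge_in_edges[OF u(1) hub_N[OF that]])
  define gap where "gap = (\<Union>i\<in>{..<m}. {s \<in> space M. \<forall>l\<in>{i..<i + R}. ?Y (Inl l) s = 0})"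
  define weak where "weak = {s \<in> space M. V (u 0) s < \<epsilon>} \<union> {s \<in> space M. V (u N) s < \<epsilon>}"
  define noisy_start where "noisy_start = (\<Union>j\<in>{..<R}. {s \<in> space M. t < \<omega> {u 0, u (hub k j)} s})"
  define noisy_end where "noisy_end = (\<Union>j\<in>{m - R..<m}. {s \<in> space M. t < \<omega> {u (hub k j), u N} s})"
  define long where "long = {s \<in> space M. (\<Sum>i<m. ?X i s) > (K + 2) * real m}"
  have noise_ev: "{s \<in> space M. t < \<omega> e s} \<in> events" if "e \<in> edges" for e
    using noise_measurable[OF that] by measurable
  have gap_ev: "{s \<in> space M. \<forall>l\<in>{i..<i + R}. ?Y (Inl l) s = 0} \<in> events" for i by measurable
  have ev: "gap \<in> events" "weak \<in> events" "noisy_start \<in> events" "noisy_end \<in> events" "long \<in> events"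
  proof -
    show "gap \<in> events" unfolding gap_def using gap_ev by (intro sets.finite_UN) auto
    show "weak \<in> events" unfolding weak_def by measurable
    show "noisy_start \<in> events" unfolding noisy_start_def using noise_ev e_first by (intro sets.finite_UN) auto
    show "noisy_end \<in> events" unfolding noisy_end_def using noise_ev e_last by (intro sets.finite_UN) auto
    show "long \<in> events" unfolding long_def using X_meas by measurable
  qed
  have "prob gap \<le> (\<Sum>i<m. prob {s \<in> space M. \<forall>l\<in>{i..<i + R}. ?Y (Inl l) s = 0})"
    unfolding gap_def by (rule measure_UNION_le) (use gap_ev in auto)
  then have p_gap: "prob gap \<le> real m * (1 - q) ^ R" by (simp add: prob_all_bad)
  have p_weak: "prob weak \<le> 2 * measure \<mu>\<^sub>V {..<\<epsilon>}"
    unfolding weak_def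
    by (rule order_trans[OF measure_Un_le]) (auto simp: prob_V_less)
  have "prob noisy_start \<le> (\<Sum>j<R. prob {s \<in> space M. t < \<omega> {u 0, u (hub k j)} s})"
    unfolding noisy_start_def by (rule measure_UNION_le) (use noise_ev e_first in auto)
  also have "\<dots> \<le> (\<Sum>j<R. ?Z / t powr \<zeta>)"
    by (intro sum_mono prob_noise_greater e_first pos)
  finally have p_first: "prob noisy_start \<le> real R * (?Z / t powr \<zeta>)" by simp
  have "prob noisy_end \<le> (\<Sum>j\<in>{m - R..<m}. prob {s \<in> space M. t < \<omega> {u (hub k j), u N} s})"
    unfolding noisy_end_def by (rule measure_UNION_le) (use noise_ev e_last in auto)
  also have "\<dots> \<le> (\<Sum>j\<in>{m - R..<m}. ?Z / t powr \<zeta>)"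
    by (intro sum_mono prob_noise_greater e_last pos) auto
  finally have p_last: "prob noisy_end \<le> real R * (?Z / t powr \<zeta>)" using R by simp
  have p_long: "prob long \<le> 2 * real R * K / real m"
    unfolding long_def
  proof (rule local_dependence_deviation[OF X_meas])
    fix i j s
    show "0 \<le> ?X i s" by (rule hop_cost_nonneg) (rule Y_01)
    show "integrable M (\<lambda>s. (?X i s)\<^sup>2)" by (rule hop_cost_second_moment(1))
    show "expectation (\<lambda>s. (?X i s)\<^sup>2) \<le> K"
      by (rule order_trans[OF hop_cost_second_moment(2) K])
    show "i + R \<le> j \<Longrightarrow> indep_var borel (?X i) borel (?X j)"
      using hop_cost_indep[of i R j \<alpha>] R by simp
  qed (use R in simp)
  have "AE s in M. s \<in> ?slow \<longrightarrow> s \<in> gap \<union> weak \<union> noisy_start \<union> noisy_end \<union> long"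
    using AE_noise_nonneg AE_space
  proof eventually_elim
    case (elim s)
    show ?case
    proof (rule impI, rule ccontr)
      assume slow: "s \<in> ?slow" and no: "s \<notin> gap \<union> weak \<union> noisy_start \<union> noisy_end \<union> long"
      have "passage_time \<alpha> (\<lambda>z. V z s) (\<lambda>e. \<omega> e s) (u 0) (u N) \<le> ereal (
        real (D * (k + 1)) powr \<alpha> / \<delta>\<^sup>2 * (\<Sum>i<m. ?X i s)
        + 2 * (real (D * ((R + 1) * (k + 1))) powr \<alpha> * t / (\<epsilon> * \<delta>)))"
      proof (rule chain_passage_time[OF u alpha_pos k(1) pos(1,2)])
        fix a b :: nat assume ab: "a < b"
        show "0 \<le> \<omega> {u a, u b} s" using elim(1) edge_in_edges[OF u(1) ab] by blast
        show "?Y (Inr (a, b)) s = \<omega> {u a, u b} s" by (simp add: line_vars_def)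
      next
        fix i assume "i + R \<le> m"
        then have "i < m" using R by simp
        then show "\<exists>l\<in>{i..<i + R}. ?Y (Inl l) s = 1"
          using no elim(2) Y_01[of _ s] by (fastforce simp: gap_def)
      next
        fix j assume "j < R"
        then show "\<omega> {u 0, u (hub k j)} s \<le> t" using no elim(2) by (auto simp: noisy_start_def not_less)
      next
        fix j assume "m - R \<le> j" "j < m"
        then show "\<omega> {u (hub k j), u N} s \<le> t" using no elim(2) by (auto simp: noisy_end_def not_less)
      qed (use no elim(2) R N line_vars_good Y_01 in \<open>auto simp: weak_def\<close>)
      also have "\<dots> \<le> ereal c"
        unfolding ereal_less_eq using no elim(2)
        by (intro order_trans[OF _ c] add_right_mono mult_left_mono) (auto simp: long_def not_less)
      finally have "passage_time \<alpha> (\<lambda>z. V z s) (\<lambda>e. \<omega> e s) (u 0) (u N) \<le> ereal c" .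
      moreover from slow have "ereal c < passage_time \<alpha> (\<lambda>z. V z s) (\<lambda>e. \<omega> e s) (u 0) (u N)"
        by (simp only: mem_Collect_eq)
      ultimately show False by (rule leD[THEN notE])
    qed
  qed
  then have "prob ?slow \<le> prob (gap \<union> weak \<union> noisy_start \<union> noisy_end \<union> long)"
    by (rule finite_measure_mono_AE) (use ev in auto)
  also have "\<dots> \<le> prob gap + prob weak + prob noisy_start + prob noisy_end + prob long"
    using ev by (intro order_trans[OF measure_Un_le] add_mono order_refl) auto
  also have "\<dots> \<le> real m * (1 - q) ^ R + 2 * measure \<mu>\<^sub>V {..<\<epsilon>}
      + real R * (?Z / t powr \<zeta>) + real R * (?Z / t powr \<zeta>) + 2 * real R * K / real m"
    by (intro add_mono p_gap p_weak p_first p_last p_long)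
  finally show ?thesis by simp
qed

text \<open>If no such \<open>\<delta>\<close> existed, the weights would almost surely not be positive.\<close>

lemma ex_weight_threshold: "\<exists>\<delta>>0. 0 < measure \<mu>\<^sub>V {\<delta>..}"
proof (rule ccontr)
  interpret \<mu>V: prob_space \<mu>\<^sub>V by (rule prob_space_\<mu>\<^sub>V)
  have sets: "sets \<mu>\<^sub>V = sets borel" using law_V[of 0] by (metis sets_distr)
  assume "\<not> ?thesis"
  then have zero: "measure \<mu>\<^sub>V {inverse (real (Suc n))..} = 0" for n
    using measure_nonneg[of \<mu>\<^sub>V] by (metis inverse_positive_iff_positive less_eq_real_def of_nat_0_less_iff zero_less_Suc)
  have "AE v in \<mu>\<^sub>V. \<forall>n. \<not> inverse (real (Suc n)) \<le> v"
  proof (subst AE_all_countable, rule allI)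
    fix n
    have "{inverse (real (Suc n))..} \<in> null_sets \<mu>\<^sub>V"
      using zero sets by (simp add: null_sets_def \<mu>V.emeasure_eq_measure)
    from AE_not_in[OF this] show "AE v in \<mu>\<^sub>V. \<not> inverse (real (Suc n)) \<le> v" by simp
  qed
  with V_pos have "AE v in \<mu>\<^sub>V. False"
  proof eventually_elim
    case (elim v)
    then show ?case using reals_Archimedean[of v] less_imp_le by blast
  qed
  then show False by simp
qed

text \<open>Right continuity at \<open>0\<close> of the distribution function of the weights, which vanishes there.\<close>

lemma small_weight_unlikely:
  assumes "(e \<longlongrightarrow> 0) F" "eventually (\<lambda>n. 0 < e n) F"
  shows "((\<lambda>n. measure \<mu>\<^sub>V {..<e n}) \<longlongrightarrow> 0) F"
proof -
  have sets: "sets \<mu>\<^sub>V = sets borel" using law_V[of 0] by (metis sets_distr)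
  interpret \<mu>V: real_distribution \<mu>\<^sub>V
    using prob_space_\<mu>\<^sub>V sets sets_eq_imp_space_eq[OF sets] by (simp add: real_distribution_def real_distribution_axioms_def)
  have "cdf \<mu>\<^sub>V 0 = 0"
    unfolding cdf_def
  proof (rule measure_eq_0_null_sets)
    have "AE v in \<mu>\<^sub>V. v \<notin> {..0}" using V_pos by eventually_elim simp
    then show "{..0} \<in> null_sets \<mu>\<^sub>V" using sets by (simp add: AE_iff_null_sets)
  qed
  then have "((cdf \<mu>\<^sub>V) \<longlongrightarrow> 0) (at_right 0)"
    using \<mu>V.cdf_is_right_cont[of 0] by (simp add: continuous_within)
  moreover have "filterlim e (at_right 0) F"
    using assms by (auto simp: filterlim_at elim: eventually_mono)
  ultimately have cdf: "((\<lambda>n. cdf \<mu>\<^sub>V (e n)) \<longlongrightarrow> 0) F"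
    by (rule filterlim_compose)
  show ?thesis
  proof (rule tendsto_sandwich[OF _ _ tendsto_const cdf])
    show "\<forall>\<^sub>F n in F. measure \<mu>\<^sub>V {..<e n} \<le> cdf \<mu>\<^sub>V (e n)"
      unfolding cdf_def using sets by (intro always_eventually allI \<mu>V.finite_measure_mono) auto
  qed simp
qed

end

section \<open>Linear growth\<close>

lemma passage_time_self: "passage_time \<alpha> v w x x \<le> 0"
proof -
  have "passage_time \<alpha> v w x x \<le> ereal (path_time \<alpha> v w [x])"
    unfolding passage_time_def by (rule INF_lower) (simp add: paths_def)
  then show ?thesis by (simp add: path_time_def zero_ereal_def)
qed

context ilrfpp
begin

text \<open>The number \<open>m\<close> of blocks grows linearly because \<open>x \<noteq> 0\<close>. The range \<open>R\<close> of order \<open>(ln n)\<^sup>2\<close> is long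
  enough that \<open>n * (1 - q) ^ R\<close> tends to \<open>0\<close>, and short enough that \<open>R / m\<close>, the probability of a large
  noise at the ends, and the cost of the end edges relative to \<open>n\<close> tend to \<open>0\<close> as well.\<close>

lemma passage_time_linear:
  fixes x :: "real ^ 'd"
  assumes x: "infnorm x \<le> 1" "x \<noteq> 0"
  shows "\<exists>C :: real. (\<lambda>n :: nat. prob {s \<in> space M.
      passage_time \<alpha> (\<lambda>z. V z s) (\<lambda>e. \<omega> e s) 0 (ceiling_vec (real n *\<^sub>R x)) > ereal (C * real n)})
    \<longlonglongrightarrow> 0"
proof -
  obtain c\<^sub>0 where c0: "x $ c\<^sub>0 \<noteq> 0" using x(2) by (auto simp: vec_eq_iff)
  define a where "a = \<bar>x $ c\<^sub>0\<bar>"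
  have a: "0 < a" using c0 by (simp add: a_def)
  have x1: "\<bar>x $ c\<bar> \<le> 1" for c
    using component_le_infnorm_cart[of x c] x(1) by linarith
  obtain k :: nat where k: "1 \<le> k" "2 / real k \<le> \<zeta>"
  proof
    have "0 < \<lceil>2 / \<zeta>\<rceil>" using zeta_pos by simp
    then show "1 \<le> nat \<lceil>2 / \<zeta>\<rceil>" by linarith
    have inv: "2 / \<kappa> \<le> \<zeta>" if "2 / \<zeta> \<le> \<kappa>" "0 < \<kappa>" for \<kappa>
      using that zeta_pos by (simp add: field_simps)
    show "2 / real (nat \<lceil>2 / \<zeta>\<rceil>) \<le> \<zeta>"
      by (rule inv) (use \<open>0 < \<lceil>2 / \<zeta>\<rceil>\<close> in linarith)+
  qed
  obtain \<delta> where \<delta>: "0 < \<delta>" "0 < measure \<mu>\<^sub>V {\<delta>..}" using ex_weight_threshold by blast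
  define q where "q = measure \<mu>\<^sub>V {\<delta>..} ^ (k + 1)"
  define \<beta> where "\<beta> = (\<integral>w. (boost k w)\<^sup>2 \<partial>\<mu>\<^sub>\<omega>)"
  define Z where "Z = (\<integral>w. w powr \<zeta> \<partial>\<mu>\<^sub>\<omega>)"
  interpret \<mu>V: prob_space \<mu>\<^sub>V by (rule prob_space_\<mu>\<^sub>V)
  have q: "0 < q" "q \<le> 1" using \<delta>(2) \<mu>V.prob_le_1 by (auto simp: q_def intro!: mult_le_one power_le_one)
  have \<beta>0: "0 \<le> \<beta>" by (simp add: \<beta>_def)
  have Z0: "0 \<le> Z" by (simp add: Z_def)
  obtain G where G: "0 \<le> G" "\<And>R. (\<Sum>s\<in>{1..R}. real s powr (2 * \<alpha>) * (1 - q) ^ (s - 1)) \<le> G"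
    using bounded_gap_moment[OF q, of "2 * \<alpha>"] by blast
  define K where "K = \<beta> ^ (2 * k) * G"
  have K: "0 \<le> K" "\<And>R. \<beta> ^ (2 * k) * (\<Sum>s\<in>{1..R}. real s powr (2 * \<alpha>) * (1 - q) ^ (s - 1)) \<le> K"
    unfolding K_def using \<beta>0 G by (auto intro!: mult_left_mono mult_nonneg_nonneg)
  define D where "D = CARD('d)"
  define A where "A = real (D * (k + 1)) powr \<alpha> / \<delta>\<^sup>2"
  define C where "C = A * (K + 2) + 1"
  define z where "z n = ceiling_vec (real n *\<^sub>R x)" for n
  define N where "N n = Max (range (\<lambda>c. nat \<bar>z n $ c\<bar>))" for n
  define m where "m n = (N n - 1) div (k + 1)" for n
  define R where "R n = Suc (nat \<lceil>(ln (real n))\<^sup>2\<rceil>)" for n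
  \<comment> \<open>With these choices \<open>t n / \<epsilon> n\<close> is only of order \<open>sqrt n\<close>, which leaves room for the factor
    \<open>R powr \<alpha>\<close> in the cost of the end edges.\<close>
  define t where "t n = real n powr (1/4)" for n
  define \<epsilon> where "\<epsilon> n = real n powr (-1/4)" for n
  \<comment> \<open>A real-valued lower bound for \<open>m n\<close>, free of rounding.\<close>
  define L where "L n = (a * real n - 2) / real (k + 1) - 1" for n
  have zc: "z n $ c = \<lceil>real n * x $ c\<rceil>" for n c by (simp add: z_def ceiling_vec_def)
  have z_le: "\<bar>z n $ c\<bar> \<le> int n" for n c
  proof -
    have "\<bar>real n * x $ c\<bar> \<le> real n" using x1[of c] by (simp add: abs_mult mult_left_le)
    then show ?thesis unfolding zc by linarith
  qed
  have N_ge: "\<bar>z n $ c\<bar> \<le> int (N n)" for n c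
  proof -
    have "nat \<bar>z n $ c\<bar> \<le> N n" unfolding N_def by (rule Max_ge) auto
    then show ?thesis by linarith
  qed
  have N_attained: "\<exists>c. \<bar>z n $ c\<bar> = int (N n)" for n
  proof -
    have "N n \<in> range (\<lambda>c. nat \<bar>z n $ c\<bar>)" unfolding N_def by (rule Max_in) auto
    then obtain c where "N n = nat \<bar>z n $ c\<bar>" by blast
    then show ?thesis by (intro exI[of _ c]) simp
  qed
  have N_le: "N n \<le> n" for n using N_attained[of n] z_le[of n] by (metis of_nat_le_iff)
  have N_lower: "a * real n - 1 \<le> real (N n)" for n
  proof -
    have "a * real n = \<bar>real n * x $ c\<^sub>0\<bar>" by (simp add: a_def abs_mult)
    also have "\<dots> \<le> real_of_int \<bar>z n $ c\<^sub>0\<bar> + 1" unfolding zc by linarith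
    also have "\<dots> \<le> real (N n) + 1" using N_ge[of n c\<^sub>0] by linarith
    finally show ?thesis by simp
  qed
  have m_le: "m n \<le> n" for n 
  proof -
    have "m n \<le> N n - 1" unfolding m_def by (rule div_le_dividend)
    then show ?thesis using N_le[of n] by linarith
  qed
  have m_lower: "L n \<le> real (m n)" for n
  proof -
    have "N n - 1 < (k + 1) + m n * (k + 1)" unfolding m_def by (rule dividend_less_div_times) simp
    then have "N n \<le> (m n + 1) * (k + 1) + 1" by simp
    then have "real (N n) \<le> real ((m n + 1) * (k + 1) + 1)" by (rule of_nat_mono)
    then have "real (N n) - 1 \<le> (real (m n) + 1) * real (k + 1)" by (simp add: algebra_simps)
    then have "a * real n - 2 \<le> (real (m n) + 1) * real (k + 1)" using N_lower[of n] by linarith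
    then have "(a * real n - 2) / real (k + 1) \<le> real (m n) + 1" by (simp add: pos_divide_le_eq del: of_nat_add of_nat_Suc)
    then show ?thesis by (simp add: L_def)
  qed
  have R_bounds: "(ln (real n))\<^sup>2 \<le> real (R n)" "real (R n) \<le> (ln (real n))\<^sup>2 + 2" "1 \<le> R n" for n
  proof -
    have "0 \<le> \<lceil>(ln (real n))\<^sup>2\<rceil>" using zero_le_power2[of "ln (real n)"] by linarith
    then show "(ln (real n))\<^sup>2 \<le> real (R n)" "real (R n) \<le> (ln (real n))\<^sup>2 + 2" "1 \<le> R n"
      unfolding R_def by linarith+
  qed
  \<comment> \<open>The bound of \<open>passage_time_deviation\<close> with \<open>m n\<close> and \<open>R n\<close> replaced by elementary functions of \<open>n\<close>.\<close>
  define B where "B n = real n * exp (- q * (ln (real n))\<^sup>2) + 2 * measure \<mu>\<^sub>V {..<\<epsilon> n}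
      + 2 * ((ln (real n))\<^sup>2 + 2) * (Z / t n powr \<zeta>) + 2 * ((ln (real n))\<^sup>2 + 2) * K / L n" for n
  have D0: "0 < real D" by (simp add: D_def)
  \<comment> \<open>Makes the \<open>R n\<close> blocks of one window fit among the \<open>m n\<close> blocks.\<close>
  have long: "eventually (\<lambda>n. (ln (real n))\<^sup>2 + 2 \<le> L n) sequentially"
    unfolding L_def using a by real_asymp
  define b where "b = real D * (real k + 1)"
  have b0: "0 < b" using D0 by (simp add: b_def)
  have ends: "eventually (\<lambda>n. 2 * ((b * ((ln (real n))\<^sup>2 + 3)) powr \<alpha> * t n / (\<epsilon> n * \<delta>)) \<le> real n) sequentially"
    unfolding t_def \<epsilon>_def using b0 alpha_pos \<delta>(1) by real_asymp
  have B_bound: "eventually (\<lambda>n. prob {s \<in> space M.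
      passage_time \<alpha> (\<lambda>z. V z s) (\<lambda>e. \<omega> e s) 0 (z n) > ereal (C * real n)} \<le> B n) sequentially"
    using long ends eventually_gt_at_top[of 0]
  proof eventually_elim
    case (elim n)
    have Rm: "R n \<le> m n" using elim(1) R_bounds(2)[of n] m_lower[of n] by linarith
    then have m0: "0 < m n" using R_bounds(3)[of n] by linarith
    have N0: "0 < N n" using m0 by (auto simp: m_def intro: gr0I)
    have N: "m n * (k + 1) < N n" "N n \<le> (m n + 1) * (k + 1)"
    proof -
      have "m n * (k + 1) \<le> N n - 1" unfolding m_def by (rule div_times_less_eq_dividend)
      then show "m n * (k + 1) < N n" using N0 by linarith
      have "N n - 1 < (k + 1) + m n * (k + 1)" unfolding m_def by (rule dividend_less_div_times) simp
      then show "N n \<le> (m n + 1) * (k + 1)" by simp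
    qed
    obtain c where c: "\<bar>z n $ c\<bar> = int (N n)" using N_attained by blast
    let ?u = "ray (z n) (N n)"
    let ?E = "2 * (real (D * ((R n + 1) * (k + 1))) powr \<alpha> * t n / (\<epsilon> n * \<delta>))"
    have pos: "0 < t n" "0 < \<epsilon> n" using elim(3) by (simp_all add: t_def \<epsilon>_def)
    have "?E \<le> 2 * ((b * ((ln (real n))\<^sup>2 + 3)) powr \<alpha> * t n / (\<epsilon> n * \<delta>))"
    proof -
      have "real (D * ((R n + 1) * (k + 1))) = b * (real (R n) + 1)"
        by (simp add: b_def algebra_simps)
      also have "\<dots> \<le> b * ((ln (real n))\<^sup>2 + 3)"
        using b0 R_bounds(2)[of n] by (intro mult_left_mono) auto
      finally show ?thesis
        using alpha_pos pos \<delta>(1)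
        by (intro mult_left_mono divide_right_mono mult_right_mono powr_mono2) auto
    qed
    then have E: "?E \<le> real n" using elim(2) by linarith
    have A0: "0 \<le> A" by (simp add: A_def)
    have "A * ((K + 2) * real (m n)) \<le> A * ((K + 2) * real n)"
      using A0 K(1) m_le[of n] by (intro mult_left_mono) auto
    then have total: "A * ((K + 2) * real (m n)) + ?E \<le> C * real n"
      using E by (simp add: C_def algebra_simps)
    have "prob {s \<in> space M. passage_time \<alpha> (\<lambda>z. V z s) (\<lambda>e. \<omega> e s) (?u 0) (?u (N n)) > ereal (C * real n)}
      \<le> real (m n) * (1 - q) ^ R n + 2 * measure \<mu>\<^sub>V {..<\<epsilon> n}
      + 2 * real (R n) * (Z / t n powr \<zeta>) + 2 * real (R n) * K / real (m n)"
      unfolding Z_def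
      by (rule passage_time_deviation[OF inj_ray[OF N0 c] _ k q_def \<beta>_def K(2) \<delta>(1) pos(2,1) R_bounds(3) Rm N
            total[unfolded A_def]])
        (unfold D_def, rule l1_norm_ray_diff[OF N0 N_ge])
    also have "\<dots> \<le> B n"
      unfolding B_def
    proof (intro add_mono order_refl)
      have "(1 - q) ^ R n \<le> exp (- q) ^ R n"
        using q exp_ge_add_one_self[of "- q"] by (intro power_mono) auto
      also have "\<dots> = exp (- q * real (R n))" by (simp flip: exp_of_nat_mult add: mult.commute)
      also have "\<dots> \<le> exp (- q * (ln (real n))\<^sup>2)" using q R_bounds(1)[of n] by simp
      finally show "real (m n) * (1 - q) ^ R n \<le> real n * exp (- q * (ln (real n))\<^sup>2)"
        using m_le[of n] q by (intro mult_mono) auto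
      show "2 * real (R n) * (Z / t n powr \<zeta>) \<le> 2 * ((ln (real n))\<^sup>2 + 2) * (Z / t n powr \<zeta>)"
        using R_bounds(2)[of n] Z0 by (intro mult_right_mono) auto
      have "0 < L n" using elim(1) by (smt (verit) zero_le_power2)
      then show "2 * real (R n) * K / real (m n) \<le> 2 * ((ln (real n))\<^sup>2 + 2) * K / L n"
        using R_bounds(2)[of n] K(1) m_lower[of n] by (intro frac_le mult_right_mono) auto
    qed
    finally show ?case using N0 by (simp add: ray_end)
  qed
  have "B \<longlonglongrightarrow> 0 + 2 * 0 + 0 + 0"
    unfolding B_def
  proof (intro tendsto_add tendsto_mult_left)
    show "(\<lambda>n. real n * exp (- q * (ln (real n))\<^sup>2)) \<longlonglongrightarrow> 0"
      using q by real_asymp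
    show "(\<lambda>n. measure \<mu>\<^sub>V {..<\<epsilon> n}) \<longlonglongrightarrow> 0"
    proof (rule small_weight_unlikely)
      show "\<epsilon> \<longlonglongrightarrow> 0" unfolding \<epsilon>_def by real_asymp
      show "eventually (\<lambda>n. 0 < \<epsilon> n) sequentially"
        using eventually_gt_at_top[of 0] by eventually_elim (simp add: \<epsilon>_def)
    qed
    show "(\<lambda>n. 2 * ((ln (real n))\<^sup>2 + 2) * (Z / t n powr \<zeta>)) \<longlonglongrightarrow> 0"
      unfolding t_def using zeta_pos by real_asymp
    show "(\<lambda>n. 2 * ((ln (real n))\<^sup>2 + 2) * K / L n) \<longlonglongrightarrow> 0"
      unfolding L_def using a by real_asymp
  qed
  then have B0: "B \<longlonglongrightarrow> 0" by simp
  show ?thesis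
    using tendsto_sandwich[OF _ B_bound tendsto_const B0]
    by (intro exI[of _ C]) (simp add: z_def)
qed

end

theorem theorem3p6:
  fixes M :: "'a measure"
    and V :: "int ^ 'd \<Rightarrow> 'a \<Rightarrow> real"
    and \<omega> :: "(int ^ 'd) set \<Rightarrow> 'a \<Rightarrow> real"
    and \<mu>\<^sub>V \<mu>\<^sub>\<omega> :: "real measure"
    and \<alpha> \<gamma> \<theta> \<zeta> :: real
  assumes "ilrfpp M V \<omega> \<mu>\<^sub>V \<mu>\<^sub>\<omega> \<alpha> \<gamma> \<theta> \<zeta>"
  shows "\<forall>x :: real ^ 'd. infnorm x \<le> 1 \<longrightarrow>
    (\<exists>C :: real.
      (\<lambda>n :: nat. measure M {s \<in> space M.
        passage_time \<alpha> (\<lambda>z. V z s) (\<lambda>e. \<omega> e s) 0 (ceiling_vec (real n *\<^sub>R x)) > ereal (C * real n)})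
      \<longlonglongrightarrow> 0)"
proof (intro allI impI)
  fix x :: "real ^ 'd"
  assume x: "infnorm x \<le> 1"
  interpret ilrfpp M V \<omega> \<mu>\<^sub>V \<mu>\<^sub>\<omega> \<alpha> \<gamma> \<theta> \<zeta> by (rule assms)
  show "\<exists>C :: real.
      (\<lambda>n :: nat. measure M {s \<in> space M.
        passage_time \<alpha> (\<lambda>z. V z s) (\<lambda>e. \<omega> e s) 0 (ceiling_vec (real n *\<^sub>R x)) > ereal (C * real n)})
      \<longlonglongrightarrow> 0"
  proof (cases "x = 0")
    case True
    have 0: "ceiling_vec (real n *\<^sub>R x) = 0" for n
      by (simp add: ceiling_vec_def True vec_eq_iff)
    have "\<not> passage_time \<alpha> (\<lambda>z. V z s) (\<lambda>e. \<omega> e s) 0 0 > ereal (0 * real n)" for s n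
      using passage_time_self by (simp add: not_less zero_ereal_def[symmetric])
    then show ?thesis unfolding 0 by (intro exI[of _ 0]) simp
  qed (use passage_time_linear[OF x] in blast)
qed

end
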